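(* Let $1<p<\infty$. (i) There is a constant $c>0$ depending only on $p$ such that for every weight $w\in A_p^+(\mathbb{R})$, $$\|M^{+}\|_{L^p_w(\mathbb{R})}\le c\,\|w\|_{A_p^+(\mathbb{R})}^{\frac1{p-1}},$$ and the exponent $\frac1{p-1}$ is best possible: there is no positive non-decreasing function $\psi$ on $[1,\infty)$ with $\psi(t)/t^{1/(p-1)}\to0$ as $t\to\infty$ such that $\|M^+\|_{L^p_w(\mathbb{R})}\le \psi(\|w\|_{A_p^+(\mathbb{R})})$ for all $w\in A_p^+(\mathbb{R})$. (ii) There is a constant $c>0$ depending only on $p$ such that for every weight $w\in A_p^-(\mathbb{R})$, $$\|M^{-}\|_{L^p_w(\mathbb{R})}\le c\,\|w\|_{A_p^-(\mathbb{R})}^{\frac1{p-1}},$$ and the exponent $\frac1{p-1}$ is best possible in the same sense: there is no positive non-decreasing function $\psi$ on $[1,\infty)$ with $\psi(t)/t^{1/(p-1)}\to0$ as $t\to\infty$ such that $\|M^-\|_{L^p_w(\mathbb{R})}\le \psi(\|w\|_{A_p^-(\mathbb{R})})$ for all $w\in A_p^-(\mathbb{R})$.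
   Context: A weight on $\mathbb{R}$ is an a.e. positive locally integrable function. $p'=p/(p-1)$. $\|f\|_{L^p_w(\mathbb{R})}=\big(\int_{\mathbb{R}}|f|^p w\,dx\big)^{1/p}$, and $\|T\|_{L^p_w(\mathbb{R})}=\sup\{\|Tf\|_{L^p_w(\mathbb{R})}:\|f\|_{L^p_w(\mathbb{R})}\le1\}$. The one-sided Hardy--Littlewood maximal operators are $$M^{+}f(x)=\sup_{h>0}\frac1h\int_x^{x+h}|f(t)|\,dt,\qquad M^{-}f(x)=\sup_{h>0}\frac1h\int_{x-h}^{x}|f(t)|\,dt .$$ $w\in A_p^{\pm}(\mathbb{R})$ means that the corresponding characteristic is finite: $$\|w\|_{A_p^+(\mathbb{R})}=\sup_{x\in\mathbb{R},h>0}\Big(\frac1h\int_{x-h}^x w\,dt\Big)\Big(\frac1h\int_x^{x+h}w^{1-p'}dt\Big)^{p-1},$$ $$\|w\|_{A_p^-(\mathbb{R})}=\sup_{x\in\mathbb{R},h>0}\Big(\frac1h\int_x^{x+h} w\,dt\Big)\Big(\frac1h\int_{x-h}^{x}w^{1-p'}dt\Big)^{p-1}.$$ *)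

theory Defs
  imports "HOL-Analysis.Analysis"
begin

(* Powers of extended nonnegative reals. Only meaningful for exponents a > 0,
   which is all that is used below; there top is sent to top and 0 to 0. *)
definition ennreal_powr :: "ennreal \<Rightarrow> real \<Rightarrow> ennreal" where
  "ennreal_powr x a = (if x = top then top else ennreal (enn2real x powr a))"

definition weight :: "(real \<Rightarrow> real) \<Rightarrow> bool" where
  "weight w \<longleftrightarrow> w \<in> borel_measurable lebesgue
     \<and> (AE x in lebesgue. 0 < w x)
     \<and> (\<forall>K. compact K \<longrightarrow> set_integrable lebesgue K w)"

definition conj_exp :: "real \<Rightarrow> real" where
  "conj_exp p = p / (p - 1)"

(* The norm is taken of [0,\<infinity>]-valued functions, so that it applies to maximal functions,
   which may be infinite; a real function f is measured through the absolute value of f. *)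
definition Lp_norm :: "real \<Rightarrow> (real \<Rightarrow> real) \<Rightarrow> (real \<Rightarrow> ennreal) \<Rightarrow> ennreal" where
  "Lp_norm p w g =
     ennreal_powr (\<integral>\<^sup>+x. ennreal_powr (g x) p * ennreal (w x) \<partial>lebesgue) (1 / p)"

definition op_norm :: "real \<Rightarrow> (real \<Rightarrow> real) \<Rightarrow> ((real \<Rightarrow> real) \<Rightarrow> real \<Rightarrow> ennreal) \<Rightarrow> ennreal" where
  "op_norm p w T =
     (SUP f \<in> {f \<in> borel_measurable lebesgue. Lp_norm p w (\<lambda>x. ennreal \<bar>f x\<bar>) \<le> 1}.
        Lp_norm p w (T f))"

definition maximal_plus :: "(real \<Rightarrow> real) \<Rightarrow> real \<Rightarrow> ennreal" where
  "maximal_plus f x =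
     (SUP h \<in> {0<..}. ennreal (1 / h) * (\<integral>\<^sup>+t\<in>{x..x + h}. ennreal \<bar>f t\<bar> \<partial>lebesgue))"

definition maximal_minus :: "(real \<Rightarrow> real) \<Rightarrow> real \<Rightarrow> ennreal" where
  "maximal_minus f x =
     (SUP h \<in> {0<..}. ennreal (1 / h) * (\<integral>\<^sup>+t\<in>{x - h..x}. ennreal \<bar>f t\<bar> \<partial>lebesgue))"

(* For a weight w the first factor below is never 0, so the convention 0 * \<infinity> = 0 of ennreal
   plays no role: the characteristic is \<infinity> as soon as w^(1-p') is not locally integrable. *)
definition Ap_plus_char :: "real \<Rightarrow> (real \<Rightarrow> real) \<Rightarrow> ennreal" where
  "Ap_plus_char p w = (SUP x. SUP h \<in> {0<..}.
     (ennreal (1 / h) * (\<integral>\<^sup>+t\<in>{x - h..x}. ennreal (w t) \<partial>lebesgue)) *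
     ennreal_powr
       (ennreal (1 / h) *
          (\<integral>\<^sup>+t\<in>{x..x + h}. ennreal (w t powr (1 - conj_exp p)) \<partial>lebesgue))
       (p - 1))"

definition Ap_minus_char :: "real \<Rightarrow> (real \<Rightarrow> real) \<Rightarrow> ennreal" where
  "Ap_minus_char p w = (SUP x. SUP h \<in> {0<..}.
     (ennreal (1 / h) * (\<integral>\<^sup>+t\<in>{x..x + h}. ennreal (w t) \<partial>lebesgue)) *
     ennreal_powr
       (ennreal (1 / h) *
          (\<integral>\<^sup>+t\<in>{x - h..x}. ennreal (w t powr (1 - conj_exp p)) \<partial>lebesgue))
       (p - 1))"

definition Ap_plus :: "real \<Rightarrow> (real \<Rightarrow> real) set" where
  "Ap_plus p = {w. weight w \<and> Ap_plus_char p w < \<infinity>}"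

definition Ap_minus :: "real \<Rightarrow> (real \<Rightarrow> real) set" where
  "Ap_minus p = {w. weight w \<and> Ap_minus_char p w < \<infinity>}"

end

(* Let s = w^(1-p') and let f be nonnegative. The upper bound compares M^+ f with the one-sided
   maximal function G x = sup over y > x of (int_x^y f) / (int_x^y s), taken with respect to s.
   By the rising sun lemma, on a component (a, b) of {M^+ f > t} one has
   t * (b - x) <= int_x^b f <= G x * int_x^b s for every x. Inserting this in the A_p^+ condition
   at x with step r = b - x gives t^(p-1) * (1/r) * int_{x-r}^x w <= A * (G x)^(p-1), and
   integration over x in (a, b) (Tonelli) gives t^(p-1) * w(a, b) <= 2 A * int_a^b G^(p-1).
   Summed over the components, this is a weak type estimate relating M^+ f to G that, with
   Doob's argument (layer cake, then Young), becomes int (M^+ f)^p w <= (2 p A)^p' * int G^p s.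
   The same argument applied to the rising sun inequality for G gives
   int G^p s <= (p')^p * int f^p w, with no constant depending on w. To keep all quantities finite,
   the argument is run for truncations of f on bounded intervals.

   The exponent is sharp for w = |x|^((p-1)(1-d)) as d -> 0: the characteristic is of order
   d^(-(p-1)), and f = x^(d-1) on (0, 1] shows that the norm is at least 1/(2 d). The statements for
   M^- follow by the reflection x -> -x. *)
theory Submission
  imports Defs
begin

text \<open>Two features of the weak type estimate carry the sharp exponent. Its right side is an
  integral over the level set itself, so it can be integrated against a power of t directly at the
  exponent p; a bound by an integral over the whole line would call for interpolation, hence for a
  weight condition with a smaller exponent. And \<open>A\<close> occurs in it to the first power
  only: Young's inequality raises it to p', and the p-th root leaves p'/p = 1/(p-1). The function
  \<open>G\<close> costs nothing more, because on the line a one-sided maximal function with respect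
  to any positive density obeys Doob's inequality with the martingale constant; no doubling is
  involved. The obstacle is the absorption in Doob's argument: a fraction of the left side is
  subtracted from it, so it must be finite beforehand. Hence f is truncated by multiples of both 1
  and s: the first bounds M^+ f, the second bounds \<open>G\<close>.\<close>

section \<open>Components of open sets on the line\<close>

lemma open_connected_bounded_real_eq_interval:
  fixes C :: "real set"
  assumes "open C" "connected C" "bounded C" "C \<noteq> {}"
  shows "C = {Inf C<..<Sup C}"
proof -
  have bdd: "bdd_below C" "bdd_above C"
    using assms by (auto simp: bounded_imp_bdd_below bounded_imp_bdd_above)
  have lo: "Inf C < x" and up: "x < Sup C" if x: "x \<in> C" for x
  proof -
    obtain e where e: "e > 0" "cball x e \<subseteq> C"
      using open_contains_cball assms(1) x by blast
    then have "x - e \<in> C" "x + e \<in> C" by (auto simp: subset_iff dist_real_def)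
    then have "Inf C \<le> x - e" "x + e \<le> Sup C"
      using bdd by (auto intro: cInf_lower cSup_upper)
    then show "Inf C < x" "x < Sup C" using e(1) by auto
  qed
  have "z \<in> C" if z: "Inf C < z" "z < Sup C" for z
  proof -
    obtain x where x: "x \<in> C" "x < z"
      using z(1) assms(4) by (meson bdd(1) cInf_less_iff)
    obtain y where y: "y \<in> C" "z < y"
      using z(2) assms(4) by (meson bdd(2) less_cSup_iff)
    have "{x..y} \<subseteq> C"
      using connected_contains_Icc[OF assms(2) x(1) y(1)] .
    with x y show ?thesis by auto
  qed
  with lo up show ?thesis by auto
qed

text \<open>A bounded open set is a countable disjoint union of intervals whose endpoints, by
  maximality, lie outside the set. These are the intervals to which the rising sun lemma applies, so
  the hypothesis asks about no others. Measures are compared rather than integrals in order to use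
  countable additivity.\<close>

lemma emeasure_open_le_by_components:
  fixes M N :: "real measure" and U :: "real set"
  assumes sets: "sets M = sets borel" "sets N = sets borel"
    and U: "open U" "bounded U"
    and le: "\<And>a b. \<lbrakk>a < b; {a<..<b} \<subseteq> U; a \<notin> U; b \<notin> U\<rbrakk>
      \<Longrightarrow> emeasure M {a<..<b} \<le> emeasure N {a<..<b}"
  shows "emeasure M U \<le> emeasure N U"
proof -
  let ?C = "components U"
  have op: "open C" if "C \<in> ?C" for C
    using open_components[OF U(1) that] .
  have pw: "pairwise disjnt ?C"
    unfolding disjnt_def by (rule pairwise_disjoint_components)
  have cnt: "countable ?C"
    using op pw by (rule countable_disjoint_open_subsets)
  have disj: "disjoint_family_on (\<lambda>C. C) ?C"
    using pw by (auto simp: disjoint_family_on_def pairwise_def disjnt_def)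
  have Un: "U = \<Union> ((\<lambda>C. C) ` ?C)"
    by simp
  have C_le: "emeasure M C \<le> emeasure N C" if C: "C \<in> ?C" for C
  proof -
    have CU: "C \<subseteq> U" and conn: "connected C" and ne: "C \<noteq> {}"
      using C by (auto dest: in_components_subset in_components_connected in_components_nonempty)
    have eq: "C = {Inf C<..<Sup C}"
      using open_connected_bounded_real_eq_interval[OF op[OF C] conn bounded_subset[OF U(2) CU] ne] .
    define a b where "a = Inf C" and "b = Sup C"
    have Cab: "C = {a<..<b}" using eq by (simp add: a_def b_def)
    have ab: "a < b" using Cab ne by auto
    have maximal: "D \<subseteq> C" if "connected D" "D \<subseteq> U" "C \<inter> D \<noteq> {}" for D
      using components_maximal[OF C that] .
    \<comment> \<open>With \<open>a\<close> in \<open>U\<close>, the connected set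
      \<open>{a..<b}\<close> would lie in \<open>U\<close> and meet \<open>C\<close>, so maximality
      would put \<open>a\<close> into \<open>C\<close>. The common point comes from
      \<open>dense\<close>.\<close>
    have "a \<notin> U"
    proof
      assume "a \<in> U"
      then have "{a..<b} \<subseteq> C"
        using ab CU Cab dense[OF ab] by (intro maximal) (auto simp: less_le)
      with Cab ab show False by force
    qed
    moreover have "b \<notin> U"
    proof
      assume "b \<in> U"
      then have "{a<..b} \<subseteq> C"
        using ab CU Cab dense[OF ab] by (intro maximal) (auto simp: less_le)
      with Cab ab show False by force
    qed
    ultimately show ?thesis
      using le[of a b] ab CU Cab by auto
  qed
  have sum: "emeasure K U = (\<integral>\<^sup>+C. emeasure K C \<partial>count_space ?C)"
    if K: "sets K = sets borel" for K :: "real measure"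
    using emeasure_UN_countable[of ?C "\<lambda>C. C" K] op cnt disj Un K by auto
  have "emeasure M U = (\<integral>\<^sup>+C. emeasure M C \<partial>count_space ?C)"
    by (rule sum[OF sets(1)])
  also have "\<dots> \<le> (\<integral>\<^sup>+C. emeasure N C \<partial>count_space ?C)"
    by (intro nn_integral_mono) (simp add: C_le)
  also have "\<dots> = emeasure N U"
    by (rule sum[OF sets(2), symmetric])
  finally show ?thesis .
qed

lemma nn_integral_open_le_by_components:
  fixes f g :: "real \<Rightarrow> ennreal" and U :: "real set"
  assumes [measurable]: "f \<in> borel_measurable borel" "g \<in> borel_measurable borel"
    and U: "open U" "bounded U"
    and le: "\<And>a b. \<lbrakk>a < b; {a<..<b} \<subseteq> U; a \<notin> U; b \<notin> U\<rbrakk>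
      \<Longrightarrow> (\<integral>\<^sup>+x\<in>{a<..<b}. f x \<partial>lborel) \<le> (\<integral>\<^sup>+x\<in>{a<..<b}. g x \<partial>lborel)"
  shows "(\<integral>\<^sup>+x\<in>U. f x \<partial>lborel) \<le> (\<integral>\<^sup>+x\<in>U. g x \<partial>lborel)"
proof -
  have eq: "emeasure (density lborel h) S = (\<integral>\<^sup>+x\<in>S. h x \<partial>lborel)"
    if "h \<in> borel_measurable borel" and "S \<in> sets borel" for h :: "real \<Rightarrow> ennreal" and S
    using that by (intro emeasure_density) simp_all
  have "emeasure (density lborel f) U \<le> emeasure (density lborel g) U"
  proof (rule emeasure_open_le_by_components)
    fix a b assume "a < b" "{a<..<b} \<subseteq> U" "a \<notin> U" "b \<notin> U"
    from le[OF this] show "emeasure (density lborel f) {a<..<b} \<le> emeasure (density lborel g) {a<..<b}"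
      by (subst (1 2) eq) simp_all
  qed (simp_all add: U)
  moreover have "U \<in> sets borel" using U(1) by simp
  ultimately show ?thesis
    using eq[OF assms(1)] eq[OF assms(2)] by metis
qed

section \<open>The layer cake formula and Doob's argument\<close>

lemma nn_integral_powr_Ioo:
  assumes "0 < q" "0 \<le> x"
  shows "(\<integral>\<^sup>+t\<in>{0<..<x}. ennreal (q * t powr (q - 1)) \<partial>lborel) = ennreal (x powr q)"
proof -
  have "((\<lambda>t. q * t powr (q - 1)) has_integral q * (x powr (q - 1 + 1) / (q - 1 + 1))) {0..x}"
    using assms by (intro has_integral_mult_right has_integral_powr_from_0) auto
  then have "((\<lambda>t. q * t powr (q - 1)) has_integral x powr q) {0<..<x}"
    using assms by (simp add: has_integral_Icc_iff_Ioo)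
  then show ?thesis
    using assms by (intro nn_integral_has_integral_lebesgue') auto
qed

text \<open>Tonelli, after \<open>X x powr q\<close> is written as the integral of
  \<open>q * t powr (q - 1)\<close> over 0 < t < X x.\<close>

lemma nn_integral_layer_cake:
  fixes X :: "'a \<Rightarrow> real" and g :: "'a \<Rightarrow> ennreal"
  assumes "sigma_finite_measure M" and [measurable]: "X \<in> borel_measurable M" "g \<in> borel_measurable M"
    and "\<And>x. 0 \<le> X x" "0 < q"
  shows "(\<integral>\<^sup>+x. ennreal (X x powr q) * g x \<partial>M) =
    (\<integral>\<^sup>+t\<in>{0<..}. ennreal (q * t powr (q - 1)) *
       (\<integral>\<^sup>+x\<in>{x. t < X x}. g x \<partial>M) \<partial>lborel)"
proof -
  interpret sigma_finite_measure M by fact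
  interpret pair_sigma_finite M "lborel :: real measure" ..
  let ?k = "\<lambda>x t. if 0 < t \<and> t < X x then ennreal (q * t powr (q - 1)) * g x else 0"
  have "(\<integral>\<^sup>+x. ennreal (X x powr q) * g x \<partial>M) = (\<integral>\<^sup>+x. (\<integral>\<^sup>+t. ?k x t \<partial>lborel) \<partial>M)"
  proof (intro nn_integral_cong)
    fix x
    have "(\<integral>\<^sup>+t. ?k x t \<partial>lborel) =
      (\<integral>\<^sup>+t. (ennreal (q * t powr (q - 1)) * indicator {0<..<X x} t) * g x \<partial>lborel)"
      by (intro nn_integral_cong) (auto split: split_indicator)
    also have "\<dots> = ennreal (X x powr q) * g x"
      using assms by (subst nn_integral_multc) (auto simp: nn_integral_powr_Ioo)
    finally show "ennreal (X x powr q) * g x = (\<integral>\<^sup>+t. ?k x t \<partial>lborel)" by simp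
  qed
  also have "\<dots> = (\<integral>\<^sup>+t. (\<integral>\<^sup>+x. ?k x t \<partial>M) \<partial>lborel)"
    by (rule Fubini'[symmetric]) measurable
  also have "\<dots> = (\<integral>\<^sup>+t. (\<integral>\<^sup>+x. (ennreal (q * t powr (q - 1)) * indicator {0<..} t) *
      (g x * indicator {x. t < X x} x) \<partial>M) \<partial>lborel)"
    by (intro nn_integral_cong) (auto split: split_indicator)
  also have "\<dots> = (\<integral>\<^sup>+t\<in>{0<..}. ennreal (q * t powr (q - 1)) *
       (\<integral>\<^sup>+x\<in>{x. t < X x}. g x \<partial>M) \<partial>lborel)"
  proof (intro nn_integral_cong)
    fix t :: real
    have [measurable]: "Measurable.pred M (\<lambda>x. t < X x)" by measurable
    have "(\<lambda>x. g x * indicator {x. t < X x} x) = (\<lambda>x. if t < X x then g x else 0)"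
      by (auto split: split_indicator)
    then have [measurable]: "(\<lambda>x. g x * indicator {x. t < X x} x) \<in> borel_measurable M"
      by simp
    show "(\<integral>\<^sup>+x. (ennreal (q * t powr (q - 1)) * indicator {0<..} t) *
      (g x * indicator {x. t < X x} x) \<partial>M) = ennreal (q * t powr (q - 1)) *
       (\<integral>\<^sup>+x\<in>{x. t < X x}. g x \<partial>M) * indicator {0<..} t"
      by (subst nn_integral_cmult) (auto simp: mult_ac)
  qed
  finally show ?thesis .
qed

text \<open>Integrated against a power of t, the hypothesis becomes an inequality between integrals
  of powers of \<open>X\<close>. Young's inequality then splits the right side so that the fraction
  (p - \<alpha>)/p of the left side reappears there; \<open>K\<close> and \<open>fin\<close> make it
  finite, so it can be subtracted. The lemma serves twice, with \<alpha> = 1 for \<open>G\<close>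
  and \<alpha> = p - 1 for M^+ f.\<close>

lemma nn_integral_powr_le_of_weak_type:
  fixes X u v :: "'a \<Rightarrow> real"
  assumes sf: "sigma_finite_measure M"
    and [measurable]: "X \<in> borel_measurable M" "u \<in> borel_measurable M" "v \<in> borel_measurable M"
    and X: "\<And>x. 0 \<le> X x" "\<And>x. X x \<le> K" and u: "\<And>x. 0 \<le> u x" and v: "\<And>x. 0 < v x"
    and \<alpha>: "0 < \<alpha>" "\<alpha> < p"
    and weak: "\<And>t. 0 < t \<Longrightarrow> ennreal (t powr \<alpha>) * (\<integral>\<^sup>+x\<in>{x. t < X x}. ennreal (v x) \<partial>M)
      \<le> (\<integral>\<^sup>+x\<in>{x. t < X x}. ennreal (u x) \<partial>M)"
    and fin: "(\<integral>\<^sup>+x\<in>{x. 0 < X x}. ennreal (v x) \<partial>M) < \<infinity>"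
  shows "(\<integral>\<^sup>+x. ennreal (X x powr p) * ennreal (v x) \<partial>M)
    \<le> ennreal ((p / (p - \<alpha>)) powr (p / \<alpha>)) * (\<integral>\<^sup>+x. ennreal ((u x / v x) powr (p / \<alpha>)) * ennreal (v x) \<partial>M)"
proof -
  \<comment> \<open>\<open>q\<close> is the power of \<open>X\<close> that remains once
    \<open>t powr \<alpha>\<close> is spent on the hypothesis, and \<open>C\<close> compares the
    coefficients: p t^(p-1) = C * q t^(q-1) * t^\<alpha>.\<close>
  define q C where "q = p - \<alpha>" and "C = p / q"
  have q: "0 < q" "q < p" "0 < p" and C: "0 < C" using \<alpha> by (auto simp: q_def C_def)
  define I J where "I = (\<integral>\<^sup>+x. ennreal (X x powr p) * ennreal (v x) \<partial>M)"
    and "J = (\<integral>\<^sup>+x. ennreal ((u x / v x) powr (p / \<alpha>)) * ennreal (v x) \<partial>M)"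
  have "I = (\<integral>\<^sup>+t\<in>{0<..}. ennreal (p * t powr (p - 1)) *
       (\<integral>\<^sup>+x\<in>{x. t < X x}. ennreal (v x) \<partial>M) \<partial>lborel)"
    unfolding I_def using q by (intro nn_integral_layer_cake[OF sf]) (auto simp: X)
  also have "\<dots> \<le> (\<integral>\<^sup>+t. ennreal C * (ennreal (q * t powr (q - 1)) *
       (\<integral>\<^sup>+x\<in>{x. t < X x}. ennreal (u x) \<partial>M) * indicator {0<..} t) \<partial>lborel)"
  proof (intro nn_integral_mono)
    fix t :: real
    show "ennreal (p * t powr (p - 1)) * (\<integral>\<^sup>+x\<in>{x. t < X x}. ennreal (v x) \<partial>M) * indicator {0<..} t
      \<le> ennreal C * (ennreal (q * t powr (q - 1)) *
         (\<integral>\<^sup>+x\<in>{x. t < X x}. ennreal (u x) \<partial>M) * indicator {0<..} t)"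
    proof (cases "0 < t")
      case True
      have "p * t powr (p - 1) = C * (q * t powr (q - 1)) * t powr \<alpha>"
        using q True by (simp add: C_def mult.assoc powr_add[symmetric]) (simp add: q_def)
      then have "ennreal (p * t powr (p - 1)) = ennreal C * ennreal (q * t powr (q - 1)) * ennreal (t powr \<alpha>)"
        using q C by (simp add: ennreal_mult)
      then show ?thesis
        using mult_left_mono[OF weak[OF True], of "ennreal C * ennreal (q * t powr (q - 1))"] True
        by (simp add: mult_ac)
    qed auto
  qed
  also have "\<dots> = ennreal C * (\<integral>\<^sup>+t\<in>{0<..}. ennreal (q * t powr (q - 1)) *
       (\<integral>\<^sup>+x\<in>{x. t < X x}. ennreal (u x) \<partial>M) \<partial>lborel)"
  proof (rule nn_integral_cmult)
    interpret sigma_finite_measure M by fact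
    have "(\<lambda>t. \<integral>\<^sup>+x\<in>{x. t < X x}. ennreal (u x) \<partial>M) =
      (\<lambda>t. \<integral>\<^sup>+x. (if t < X x then ennreal (u x) else 0) \<partial>M)"
      by (intro ext nn_integral_cong) (auto split: split_indicator)
    moreover have "\<dots> \<in> borel_measurable lborel"
      by measurable
    ultimately have [measurable]: "(\<lambda>t. \<integral>\<^sup>+x\<in>{x. t < X x}. ennreal (u x) \<partial>M) \<in> borel_measurable lborel"
      by simp
    show "(\<lambda>t. ennreal (q * t powr (q - 1)) * (\<integral>\<^sup>+x\<in>{x. t < X x}. ennreal (u x) \<partial>M) *
       indicator {0<..} t) \<in> borel_measurable lborel"
      by measurable
  qed
  also have "\<dots> = ennreal C * (\<integral>\<^sup>+x. ennreal (X x powr q) * ennreal (u x) \<partial>M)"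
    using q by (subst nn_integral_layer_cake[OF sf, symmetric]) (auto simp: X)
  also have "\<dots> = (\<integral>\<^sup>+x. ennreal C * (ennreal (X x powr q) * ennreal (u x)) \<partial>M)"
    by (rule nn_integral_cmult[symmetric]) measurable
  also have "\<dots> \<le> (\<integral>\<^sup>+x. ennreal (q / p) * (ennreal (X x powr p) * ennreal (v x)) +
      ennreal (\<alpha> / p * C powr (p / \<alpha>)) * (ennreal ((u x / v x) powr (p / \<alpha>)) * ennreal (v x)) \<partial>M)"
  proof (intro nn_integral_mono)
    fix x
    have CB: "(C * (u x / v x)) powr (p / \<alpha>) = C powr (p / \<alpha>) * (u x / v x) powr (p / \<alpha>)"
      by (rule powr_mult)
    \<comment> \<open>The conjugate exponents are p/q and p/\<alpha>, and \<open>u\<close> is read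
      as (u/v) v. With \<open>C\<close> kept in the second factor, that term gets the coefficient
      \<alpha>/p = 1 - q/p, which cancels after the absorption.\<close>
    have "X x powr q * (C * (u x / v x)) \<le> (X x powr q) powr (p / q) / (p / q)
      + (C * (u x / v x)) powr (p / \<alpha>) / (p / \<alpha>)"
      using q \<alpha> C u v[of x] by (intro Youngs_inequality) (auto simp: q_def field_simps)
    also have "\<dots> = q / p * X x powr p + \<alpha> / p * C powr (p / \<alpha>) * (u x / v x) powr (p / \<alpha>)"
      using q \<alpha> unfolding CB powr_powr by (simp add: mult_ac)
    finally have "X x powr q * (C * (u x / v x)) * v x \<le>
      (q / p * X x powr p + \<alpha> / p * C powr (p / \<alpha>) * (u x / v x) powr (p / \<alpha>)) * v x"
      using v[of x] by (intro mult_right_mono) auto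
    then have "C * (X x powr q * u x) \<le> q / p * (X x powr p * v x) +
        \<alpha> / p * C powr (p / \<alpha>) * ((u x / v x) powr (p / \<alpha>) * v x)"
      using v[of x] by (simp add: algebra_simps)
    then show "ennreal C * (ennreal (X x powr q) * ennreal (u x))
      \<le> ennreal (q / p) * (ennreal (X x powr p) * ennreal (v x)) +
      ennreal (\<alpha> / p * C powr (p / \<alpha>)) * (ennreal ((u x / v x) powr (p / \<alpha>)) * ennreal (v x))"
      using q \<alpha> C u[of x] v[of x]
      by (simp add: ennreal_mult[symmetric] ennreal_plus[symmetric] ennreal_leI del: ennreal_plus)
  qed
  also have "\<dots> = ennreal (q / p) * I + ennreal (\<alpha> / p * C powr (p / \<alpha>)) * J"
    unfolding I_def J_def by (simp add: nn_integral_add nn_integral_cmult)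
  finally have le: "I \<le> ennreal (q / p) * I + ennreal (\<alpha> / p * C powr (p / \<alpha>)) * J" .
  \<comment> \<open>\<open>X\<close> is at most \<open>K\<close> and vanishes off a set of finite
    \<open>v\<close>-measure.\<close>
  have "I \<le> (\<integral>\<^sup>+x. ennreal (K powr p) * (ennreal (v x) * indicator {x. 0 < X x} x) \<partial>M)"
    unfolding I_def
  proof (intro nn_integral_mono)
    fix x
    have "ennreal (X x powr p) \<le> ennreal (K powr p)"
      using X q by (intro ennreal_leI powr_mono2) auto
    then show "ennreal (X x powr p) * ennreal (v x) \<le> ennreal (K powr p) * (ennreal (v x) * indicator {x. 0 < X x} x)"
      using X(1)[of x] by (cases "X x = 0") (auto simp: mult_right_mono less_le)
  qed
  also have "\<dots> = ennreal (K powr p) * (\<integral>\<^sup>+x\<in>{x. 0 < X x}. ennreal (v x) \<partial>M)"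
  proof (rule nn_integral_cmult)
    have "(\<lambda>x. ennreal (v x) * indicator {x. 0 < X x} x) = (\<lambda>x. if 0 < X x then ennreal (v x) else 0)"
      by (auto split: split_indicator)
    then show "(\<lambda>x. ennreal (v x) * indicator {x. 0 < X x} x) \<in> borel_measurable M"
      by simp
  qed
  also have "\<dots> < \<infinity>" using fin by (simp add: ennreal_mult_less_top)
  finally have I_fin: "I < \<infinity>" .
  have "I \<le> ennreal (C powr (p / \<alpha>)) * J"
  proof (cases "J = \<infinity>")
    case True
    \<comment> \<open>Positivity of \<open>C\<close> makes the right side infinite and excludes 0 *
      \<infinity> = 0.\<close>
    then show ?thesis using C by (simp add: ennreal_mult_top)
  next
    case False
    then obtain i j where ij: "I = ennreal i" "J = ennreal j" "0 \<le> i" "0 \<le> j"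
      using I_fin by (cases I; cases J) auto
    have "i \<le> q / p * i + \<alpha> / p * C powr (p / \<alpha>) * j"
      using le q \<alpha> ij
      by (simp add: ij ennreal_mult[symmetric] ennreal_plus[symmetric] del: ennreal_plus)
    moreover have "q / p * i = i - \<alpha> / p * i"
      using q by (simp add: q_def field_simps)
    ultimately have "\<alpha> / p * i \<le> \<alpha> / p * (C powr (p / \<alpha>) * j)" by simp
    then have "i \<le> C powr (p / \<alpha>) * j"
      using \<alpha> by (subst (asm) mult_le_cancel_left_pos) auto
    then show ?thesis
      using ij by (simp add: ennreal_mult[symmetric] ennreal_leI)
  qed
  then show ?thesis by (simp add: I_def J_def C_def q_def)
qed

section \<open>One-sided maximal functions and the rising sun lemma\<close>

definition quotient_max :: "real \<Rightarrow> real \<Rightarrow> (real \<Rightarrow> real) \<Rightarrow> (real \<Rightarrow> real) \<Rightarrow> real \<Rightarrow> real" where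
  "quotient_max a b f v x =
     (if x \<in> {a<..<b} then (SUP y\<in>{x<..b}. integral {x..y} f / integral {x..y} v) else 0)"

lemma integral_Icc_pos:
  fixes v :: "real \<Rightarrow> real"
  assumes "v integrable_on {x..y}" "x < y" "\<And>t. 0 < v t" "v \<in> borel_measurable borel"
  shows "0 < integral {x..y} v"
proof (rule ccontr)
  assume "\<not> 0 < integral {x..y} v"
  moreover have "0 \<le> integral {x..y} v"
    using assms by (intro integral_nonneg) (auto simp: less_imp_le)
  ultimately have "(v has_integral 0) {x..y}"
    using assms(1) by (metis has_integral_integral less_eq_real_def)
  then have "(\<integral>\<^sup>+t\<in>{x..y}. ennreal (v t) \<partial>lborel) = 0"
    using nn_integral_has_integral_lebesgue'[of "{x..y}" v 0] assms(3) by (simp add: less_imp_le)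
  then have "AE t in lborel. ennreal (v t) * indicator {x..y} t = 0"
    using assms(4) by (subst (asm) nn_integral_0_iff_AE) auto
  then have "AE t in lborel. t \<notin> {x..y}"
    by (rule AE_mp) (use assms(3) in \<open>auto split: split_indicator_asm simp: ennreal_eq_0_iff not_le[symmetric] intro!: AE_I2\<close>)
  then have "emeasure lborel {x..y} = 0"
    by (subst (asm) AE_iff_measurable[of "{x..y}"]) auto
  then show False using assms(2) by simp
qed

lemma nn_integral_Icc:
  fixes g :: "real \<Rightarrow> real"
  assumes "g integrable_on {x..y}" "\<And>t. 0 \<le> g t"
  shows "(\<integral>\<^sup>+t\<in>{x..y}. ennreal (g t) \<partial>lborel) = ennreal (integral {x..y} g)"
  using assms by (intro nn_integral_has_integral_lebesgue') auto

lemma nn_integral_Ioo: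
  fixes g :: "real \<Rightarrow> real"
  assumes "g integrable_on {x..y}" "\<And>t. 0 \<le> g t"
  shows "(\<integral>\<^sup>+t\<in>{x<..<y}. ennreal (g t) \<partial>lborel) = ennreal (integral {x..y} g)"
  using assms by (intro nn_integral_has_integral_lebesgue')
    (auto simp: has_integral_Icc_iff_Ioo[symmetric])

lemma integrable_on_Icc_of_nn_integral:
  fixes g :: "real \<Rightarrow> real"
  assumes [measurable]: "g \<in> borel_measurable borel" and "\<And>t. 0 \<le> g t"
    and "(\<integral>\<^sup>+t\<in>{x..y}. ennreal (g t) \<partial>lborel) < \<infinity>"
  shows "g integrable_on {x..y}"
proof -
  have "(\<integral>\<^sup>+t. ennreal (if t \<in> {x..y} then g t else 0) \<partial>lborel) = (\<integral>\<^sup>+t\<in>{x..y}. ennreal (g t) \<partial>lborel)"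
    by (intro nn_integral_cong) (auto split: split_indicator)
  then have "(\<lambda>t. if t \<in> {x..y} then g t else 0) integrable_on UNIV"
    using assms by (intro nn_integral_integrable_on) auto
  then show ?thesis by (simp only: integrable_restrict_UNIV)
qed

lemma integrable_on_Icc_dominated:
  fixes f g :: "real \<Rightarrow> real"
  assumes f: "f \<in> borel_measurable borel" "\<And>t. 0 \<le> f t" and le: "\<And>t. f t \<le> g t"
    and g: "g integrable_on {x..y}"
  shows "f integrable_on {x..y}"
  using f
proof (rule integrable_on_Icc_of_nn_integral)
  have "(\<integral>\<^sup>+t\<in>{x..y}. ennreal (f t) \<partial>lborel) \<le> (\<integral>\<^sup>+t\<in>{x..y}. ennreal (g t) \<partial>lborel)"
    by (intro nn_integral_mono mult_right_mono ennreal_leI le) simp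
  also have "\<dots> = ennreal (integral {x..y} g)"
    using f(2) le by (intro nn_integral_Icc[OF g]) (metis order_trans)
  finally show "(\<integral>\<^sup>+t\<in>{x..y}. ennreal (f t) \<partial>lborel) < \<infinity>"
    by (simp add: le_less_trans)
qed

text \<open>The bound f \<le> K v makes every quotient at most \<open>K\<close>. So the supremum in
  \<open>quotient_max\<close> is a genuine real number, and Doob's argument has its a priori
  bound.\<close>

locale quotient_pair =
  fixes a b K :: real and f v :: "real \<Rightarrow> real"
  assumes f_meas [measurable]: "f \<in> borel_measurable borel"
    and v_meas [measurable]: "v \<in> borel_measurable borel"
    and f_nonneg: "\<And>x. 0 \<le> f x" and v_pos: "\<And>x. 0 < v x" and f_le: "\<And>x. f x \<le> K * v x"
    and v_int_ab: "v integrable_on {a..b}"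
begin

lemma v_int: "\<lbrakk>a \<le> x; y \<le> b\<rbrakk> \<Longrightarrow> v integrable_on {x..y}"
  using v_int_ab by (rule integrable_on_subinterval) auto

lemma f_int: "\<lbrakk>a \<le> x; y \<le> b\<rbrakk> \<Longrightarrow> f integrable_on {x..y}"
  using f_meas f_nonneg f_le by (rule integrable_on_Icc_dominated) (auto intro!: integrable_on_mult_right v_int)

lemma v_integral_pos: "\<lbrakk>a \<le> x; x < y; y \<le> b\<rbrakk> \<Longrightarrow> 0 < integral {x..y} v"
  by (intro integral_Icc_pos v_int v_pos v_meas) auto

lemma f_integral_nonneg: "\<lbrakk>a \<le> x; y \<le> b\<rbrakk> \<Longrightarrow> 0 \<le> integral {x..y} f"
  by (intro integral_nonneg f_int f_nonneg) auto

lemma f_integral_le: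
  assumes "a \<le> x" "y \<le> b"
  shows "integral {x..y} f \<le> K * integral {x..y} v"
proof -
  have "integral {x..y} f \<le> integral {x..y} (\<lambda>t. K * v t)"
    using assms by (intro integral_le f_int integrable_on_mult_right v_int f_le) auto
  then show ?thesis by simp
qed

lemma K_nonneg: "0 \<le> K"
  using f_le[of 0] f_nonneg[of 0] v_pos[of 0] by (metis dual_order.trans mult_neg_pos not_le)

lemma quotient_bounds:
  assumes "a \<le> x" "x < y" "y \<le> b"
  shows "0 \<le> integral {x..y} f / integral {x..y} v" "integral {x..y} f / integral {x..y} v \<le> K"
  using v_integral_pos[OF assms] f_integral_nonneg[of x y] f_integral_le[of x y] assms
  by (auto simp: field_simps)

lemma quotient_bdd_above:
  "a \<le> x \<Longrightarrow> bdd_above ((\<lambda>y. integral {x..y} f / integral {x..y} v) ` {x<..b})"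
  using quotient_bounds by (intro bdd_aboveI2[where M=K]) auto

lemma quotient_le_quotient_max:
  assumes "a < x" "x < y" "y \<le> b"
  shows "integral {x..y} f / integral {x..y} v \<le> quotient_max a b f v x"
  using assms quotient_bdd_above[of x] by (auto simp: quotient_max_def intro!: cSUP_upper2)

lemma quotient_max_nonneg: "0 \<le> quotient_max a b f v x"
proof (cases "x \<in> {a<..<b}")
  case True
  then show ?thesis
    using quotient_bounds(1)[of x b] quotient_le_quotient_max[of x b] by simp
qed (auto simp: quotient_max_def)

lemma quotient_max_le: "quotient_max a b f v x \<le> K"
  using K_nonneg quotient_bounds(2) by (auto simp: quotient_max_def intro!: cSUP_least)

lemma less_quotient_max_iff:
  assumes "a < x" "x < b"
  shows "t < quotient_max a b f v x \<longleftrightarrow> (\<exists>y\<in>{x<..b}. t * integral {x..y} v < integral {x..y} f)"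
proof -
  have "t < quotient_max a b f v x \<longleftrightarrow> (\<exists>y\<in>{x<..b}. t < integral {x..y} f / integral {x..y} v)"
    using assms quotient_bdd_above[of x] by (auto simp: quotient_max_def less_cSUP_iff)
  also have "\<dots> \<longleftrightarrow> (\<exists>y\<in>{x<..b}. t * integral {x..y} v < integral {x..y} f)"
    using assms v_integral_pos[of x] by (intro bex_cong refl) (auto simp: pos_less_divide_eq)
  finally show ?thesis .
qed

text \<open>The function of Riesz's rising sun lemma. On [a, b], \<open>rise t y - rise t x\<close>
  is the integral of f - t v over [x, y], so a point lies in the level set of
  \<open>quotient_max\<close> when a strictly larger value of \<open>rise t\<close> is visible to
  its right, up to b.\<close>

definition rise :: "real \<Rightarrow> real \<Rightarrow> real" where
  "rise t x = integral {a..x} f - t * integral {a..x} v"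

lemma rise_diff:
  assumes "a \<le> x" "x \<le> y" "y \<le> b"
  shows "rise t y - rise t x = integral {x..y} f - t * integral {x..y} v"
proof -
  have "integral {a..y} f = integral {a..x} f + integral {x..y} f"
    "integral {a..y} v = integral {a..x} v + integral {x..y} v"
    using assms f_int[of a y] v_int[of a y]
    by (auto simp: Henstock_Kurzweil_Integration.integral_combine)
  then show ?thesis by (simp add: rise_def algebra_simps)
qed

lemma continuous_on_rise: "continuous_on {a..b} (rise t)"
  unfolding rise_def
  by (intro continuous_intros indefinite_integral_continuous_1 f_int v_int) auto

lemma less_quotient_max_iff_rise:
  assumes "a < x" "x < b"
  shows "t < quotient_max a b f v x \<longleftrightarrow> (\<exists>y\<in>{x<..b}. rise t x < rise t y)"
proof -
  have "t * integral {x..y} v < integral {x..y} f \<longleftrightarrow> rise t x < rise t y" if "y \<in> {x<..b}" for y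
    using rise_diff[of x y t] assms that by auto
  then show ?thesis
    using less_quotient_max_iff[OF assms] by blast
qed

lemma level_subset: "0 \<le> t \<Longrightarrow> {x. t < quotient_max a b f v x} \<subseteq> {a<..<b}"
  by (auto simp: quotient_max_def split: if_splits)

text \<open>For each fixed y the points x in (a, y) with \<open>rise t x < rise t y\<close> form an
  open set by continuity, and the level set is the union over y. The condition 0 \<le> t keeps it
  inside (a, b), where the description by \<open>rise\<close> is valid.\<close>

lemma open_level:
  assumes "0 \<le> t"
  shows "open {x. t < quotient_max a b f v x}"
proof -
  have "{x. t < quotient_max a b f v x} = (\<Union>y\<in>{a..b}. {a<..<y} \<inter> rise t -` {..<rise t y})"
    (is "?L = ?R")
  proof (intro set_eqI iffI)
    fix x assume x: "x \<in> ?L"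
    then have ab: "a < x" "x < b" using level_subset[OF assms] by auto
    with x show "x \<in> ?R" by (force simp: less_quotient_max_iff_rise)
  next
    fix x assume "x \<in> ?R"
    then obtain y where "y \<le> b" "a < x" "x < y" "rise t x < rise t y" by auto
    then show "x \<in> ?L" by (auto simp: less_quotient_max_iff_rise)
  qed
  also have "open \<dots>"
    by (intro open_UN ballI continuous_open_preimage continuous_on_subset[OF continuous_on_rise]) auto
  finally show ?thesis .
qed

lemma quotient_max_measurable [measurable]: "quotient_max a b f v \<in> borel_measurable borel"
proof (subst borel_measurable_iff_greater, intro allI)
  fix t :: real
  show "{x \<in> space borel. t < quotient_max a b f v x} \<in> sets borel"
  proof (cases "0 \<le> t")
    case False
    then have "{x. t < quotient_max a b f v x} = UNIV"
      using quotient_max_nonneg by (auto intro: less_le_trans[of t 0])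
    then show ?thesis by simp
  qed (simp add: open_level)
qed

text \<open>The rising sun lemma: a maximiser of \<open>rise t\<close> on \<open>[x, \<beta>]\<close> must be \<open>\<beta>\<close>,
  since from any other point a larger value is seen to the right of \<open>\<beta>\<close>, which would put \<open>\<beta>\<close>
  into the level set.\<close>
lemma rise_le_right_endpoint:
  assumes t: "0 \<le> t" and sub: "{\<alpha><..<\<beta>} \<subseteq> {x. t < quotient_max a b f v x}"
    and \<beta>: "\<not> t < quotient_max a b f v \<beta>" and x: "\<alpha> < x" "x < \<beta>"
  shows "rise t x \<le> rise t \<beta>"
proof -
  have ab: "{\<alpha><..<\<beta>} \<subseteq> {a<..<b}" using sub level_subset[OF t] by blast
  then have "a \<le> \<alpha>" "\<beta> \<le> b"
    using x by (auto simp: greaterThanLessThan_subseteq_greaterThanLessThan)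
  then have "compact {x..\<beta>}" "{x..\<beta>} \<noteq> {}" "continuous_on {x..\<beta>} (rise t)"
    using x by (auto intro: continuous_on_subset[OF continuous_on_rise])
  then obtain z where z: "z \<in> {x..\<beta>}" "\<And>y. y \<in> {x..\<beta>} \<Longrightarrow> rise t y \<le> rise t z"
    by (meson continuous_attains_sup)
  have "z = \<beta>"
  proof (rule ccontr)
    assume "z \<noteq> \<beta>"
    then have "z \<in> {\<alpha><..<\<beta>}" using z(1) x by auto
    then have "t < quotient_max a b f v z" "a < z" "z < b" using sub ab by auto
    then obtain y where y: "z < y" "y \<le> b" "rise t z < rise t y"
      by (auto simp: less_quotient_max_iff_rise)
    then have "\<beta> < y" using z x by (metis atLeastAtMost_iff leD le_less_linear less_le_trans less_imp_le)
    moreover have "rise t \<beta> < rise t y" using z(2)[of \<beta>] x y by auto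
    ultimately have "t < quotient_max a b f v \<beta>"
      using y x \<open>a \<le> \<alpha>\<close> by (subst less_quotient_max_iff_rise) auto
    with \<beta> show False by simp
  qed
  with z(2)[of x] x show ?thesis by auto
qed

lemma weak_type_quotient_max:
  assumes t: "0 \<le> t"
  shows "ennreal t * (\<integral>\<^sup>+x\<in>{x. t < quotient_max a b f v x}. ennreal (v x) \<partial>lborel)
    \<le> (\<integral>\<^sup>+x\<in>{x. t < quotient_max a b f v x}. ennreal (f x) \<partial>lborel)"
proof -
  let ?U = "{x. t < quotient_max a b f v x}"
  have "(\<integral>\<^sup>+x\<in>?U. ennreal t * ennreal (v x) \<partial>lborel) \<le> (\<integral>\<^sup>+x\<in>?U. ennreal (f x) \<partial>lborel)"
  proof (rule nn_integral_open_le_by_components)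
    fix \<alpha> \<beta> assume \<alpha>\<beta>: "\<alpha> < \<beta>" "{\<alpha><..<\<beta>} \<subseteq> ?U" "\<alpha> \<notin> ?U" "\<beta> \<notin> ?U"
    have ab: "a \<le> \<alpha>" "\<beta> \<le> b"
      using \<alpha>\<beta>(1,2) level_subset[OF t]
      by (meson greaterThanLessThan_subseteq_greaterThanLessThan order_trans not_le)+
    \<comment> \<open>The rising sun lemma treats points inside the component; continuity carries
      the inequality to the left endpoint.\<close>
    have "rise t \<alpha> \<le> rise t \<beta>"
    proof (rule continuous_le_on_closure[of "{\<alpha><..<\<beta>}" "rise t"])
      show "continuous_on (closure {\<alpha><..<\<beta>}) (rise t)" "\<alpha> \<in> closure {\<alpha><..<\<beta>}"
        using \<alpha>\<beta>(1) ab by (auto intro: continuous_on_subset[OF continuous_on_rise])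
      show "rise t x \<le> rise t \<beta>" if "x \<in> {\<alpha><..<\<beta>}" for x
        using rise_le_right_endpoint[OF t \<alpha>\<beta>(2), of x] \<alpha>\<beta>(4) that by auto
    qed
    then have "t * integral {\<alpha>..\<beta>} v \<le> integral {\<alpha>..\<beta>} f"
      using rise_diff[of \<alpha> \<beta> t] ab \<alpha>\<beta>(1) by auto
    then show "(\<integral>\<^sup>+x\<in>{\<alpha><..<\<beta>}. ennreal t * ennreal (v x) \<partial>lborel)
      \<le> (\<integral>\<^sup>+x\<in>{\<alpha><..<\<beta>}. ennreal (f x) \<partial>lborel)"
      using nn_integral_Ioo[OF f_int[OF ab]] f_nonneg v_pos t
        nn_integral_Ioo[of "\<lambda>x. t * v x" \<alpha> \<beta>] integrable_on_mult_right[OF v_int[OF ab], of t]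
      by (simp add: ennreal_mult[symmetric] less_imp_le ennreal_leI)
  next
    show "bounded ?U"
      using bounded_subset[OF _ level_subset[OF t]] by simp
  qed (use t open_level in auto)
  moreover have "(\<integral>\<^sup>+x\<in>?U. ennreal t * ennreal (v x) \<partial>lborel)
    = ennreal t * (\<integral>\<^sup>+x\<in>?U. ennreal (v x) \<partial>lborel)"
    using open_level[OF t] by (subst nn_integral_cmult[symmetric]) (auto simp: mult.assoc)
  ultimately show ?thesis by simp
qed

text \<open>Doob's argument with \<alpha> = 1 and u = f. The constant is that of the martingale
  inequality, the same for every \<open>v\<close>.\<close>

lemma strong_type_quotient_max:
  assumes p: "1 < p"
  shows "(\<integral>\<^sup>+x. ennreal (quotient_max a b f v x powr p) * ennreal (v x) \<partial>lborel)
    \<le> ennreal ((p / (p - 1)) powr p) * (\<integral>\<^sup>+x. ennreal ((f x / v x) powr p) * ennreal (v x) \<partial>lborel)"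
proof -
  have "(\<integral>\<^sup>+x\<in>{x. 0 < quotient_max a b f v x}. ennreal (v x) \<partial>lborel)
    \<le> (\<integral>\<^sup>+x\<in>{a..b}. ennreal (v x) \<partial>lborel)"
    using level_subset[of 0] by (intro nn_integral_mono) (auto split: split_indicator)
  also have "\<dots> < \<infinity>"
    using nn_integral_Icc[OF v_int_ab] v_pos by (simp add: less_imp_le)
  finally show ?thesis
    using nn_integral_powr_le_of_weak_type[OF lborel.sigma_finite_measure_axioms,
        of "quotient_max a b f v" f v K 1 p]
      weak_type_quotient_max p quotient_max_nonneg quotient_max_le f_nonneg v_pos
    by simp
qed

end

section \<open>The weighted estimate on a bounded interval\<close>

text \<open>\<open>A\<close> is any bound for the characteristic, which is expressed here by real
  integrals. Local integrability of \<open>s\<close> is a consequence of a finite characteristic,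
  derived in \<open>Ap_plus_weight_borel_version\<close>.\<close>

locale Ap_plus_weight =
  fixes p A :: real and w s :: "real \<Rightarrow> real"
  assumes p: "1 < p" and A_nonneg: "0 \<le> A"
    and w_meas [measurable]: "w \<in> borel_measurable borel"
    and w_pos: "\<And>x. 0 < w x"
    and s_eq: "s = (\<lambda>x. w x powr (1 - conj_exp p))"
    and w_int: "\<And>x y. w integrable_on {x..y}"
    and s_int: "\<And>x y. s integrable_on {x..y}"
    and Ap: "\<And>x h. 0 < h \<Longrightarrow>
      (integral {x - h..x} w / h) * (integral {x..x + h} s / h) powr (p - 1) \<le> A"
begin

lemma s_meas [measurable]: "s \<in> borel_measurable borel"
  unfolding s_eq by measurable

lemma s_pos: "0 < s x"
  using w_pos[of x] by (simp add: s_eq)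

end

text \<open>The two upper bounds on \<open>f\<close> are those that the pairs (f, 1) and (f, s)
  require of a \<open>quotient_pair\<close>.\<close>

locale Ap_plus_bounded = Ap_plus_weight +
  fixes a b K :: real and f :: "real \<Rightarrow> real"
  assumes f_meas: "f \<in> borel_measurable borel" and f_nonneg: "\<And>x. 0 \<le> f x"
    and f_le_const: "\<And>x. f x \<le> K" and f_le_s: "\<And>x. f x \<le> K * s x"
begin

sublocale X: quotient_pair a b K f "\<lambda>_. 1"
  using f_meas f_nonneg f_le_const by unfold_locales auto

sublocale G: quotient_pair a b K f s
  using f_meas f_nonneg f_le_s s_pos s_int by unfold_locales auto

abbreviation X where "X \<equiv> quotient_max a b f (\<lambda>_. 1)"
abbreviation G where "G \<equiv> quotient_max a b f s"

text \<open>\<open>2 * x - \<beta>\<close> is x - r for r = \<beta> - x. The right window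
  [x, \<beta>] ends where the component ends, while the left one may leave the component and even
  (a, b).\<close>

lemma average_w_le:
  assumes t: "0 \<le> t" and sub: "{\<alpha><..<\<beta>} \<subseteq> {x. t < X x}" and \<beta>: "\<not> t < X \<beta>"
    and x: "\<alpha> < x" "x < \<beta>"
  shows "t powr (p - 1) * (integral {2 * x - \<beta>..x} w / (\<beta> - x)) \<le> A * G x powr (p - 1)"
proof -
  have "{\<alpha><..<\<beta>} \<subseteq> {a<..<b}" using sub X.level_subset[OF t] by blast
  with x have ab: "a \<le> \<alpha>" "\<beta> \<le> b"
    by (auto simp: greaterThanLessThan_subseteq_greaterThanLessThan)
  define r S W where "r = \<beta> - x" and "S = integral {x..\<beta>} s" and "W = integral {2 * x - \<beta>..x} w"
  have r: "0 < r" using x by (simp add: r_def)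
  have S: "0 < S" unfolding S_def using ab x by (intro G.v_integral_pos) auto
  have "0 \<le> W" unfolding W_def using w_pos by (intro integral_nonneg w_int) (auto simp: less_imp_le)
  have "t * r \<le> integral {x..\<beta>} f"
    using X.rise_le_right_endpoint[OF t sub \<beta> x] X.rise_diff[of x \<beta> t] ab x by (simp add: r_def)
  also have "\<dots> \<le> G x * S"
    using G.quotient_le_quotient_max[of x \<beta>] ab x S by (simp add: S_def pos_divide_le_eq)
  finally have "t \<le> G x * (S / r)"
    using r by (simp add: pos_le_divide_eq)
  then have "t powr (p - 1) \<le> (G x * (S / r)) powr (p - 1)"
    using t p by (intro powr_mono2) auto
  also have "\<dots> = G x powr (p - 1) * (S / r) powr (p - 1)"
    by (rule powr_mult)
  finally have "t powr (p - 1) * (W / r) \<le> G x powr (p - 1) * (S / r) powr (p - 1) * (W / r)"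
    using \<open>0 \<le> W\<close> r by (intro mult_right_mono) auto
  also have "\<dots> = (W / r * (S / r) powr (p - 1)) * G x powr (p - 1)"
    by simp
  also have "\<dots> \<le> A * G x powr (p - 1)"
    using Ap[OF r, of x] by (intro mult_right_mono) (auto simp: W_def S_def r_def)
  finally show ?thesis by (simp add: W_def r_def)
qed

text \<open>The kernel \<open>k\<close> has \<open>1 / (\<beta> - u)\<close> in place of the larger \<open>1 / (\<beta> - x)\<close>, so that its integral
  over \<open>x\<close> is that of a constant.\<close>
lemma weak_type_component:
  assumes t: "0 \<le> t" and sub: "{\<alpha><..<\<beta>} \<subseteq> {x. t < X x}" and \<beta>: "\<not> t < X \<beta>"
  shows "(\<integral>\<^sup>+u\<in>{\<alpha><..<\<beta>}. ennreal (t powr (p - 1) / 2) * ennreal (w u) \<partial>lborel)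
    \<le> (\<integral>\<^sup>+x\<in>{\<alpha><..<\<beta>}. ennreal (A * G x powr (p - 1)) \<partial>lborel)"
proof -
  define k where "k x u = (if \<alpha> < u \<and> u < \<beta> \<and> u \<le> x \<and> x \<le> (u + \<beta>) / 2
    then ennreal (t powr (p - 1) * w u / (\<beta> - u)) else 0)" for x u
  have [measurable]: "(\<lambda>z. k (fst z) (snd z)) \<in> borel_measurable (borel \<Otimes>\<^sub>M borel)"
    unfolding k_def by measurable
  \<comment> \<open>For fixed u the kernel lives on u \<le> x \<le> (u + \<beta>)/2, an interval of
    length (\<beta> - u)/2; hence the factor 1/2.\<close>
  have "(\<integral>\<^sup>+u\<in>{\<alpha><..<\<beta>}. ennreal (t powr (p - 1) / 2) * ennreal (w u) \<partial>lborel)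
    = (\<integral>\<^sup>+u. (\<integral>\<^sup>+x. k x u \<partial>lborel) \<partial>lborel)"
  proof (intro nn_integral_cong)
    fix u
    show "ennreal (t powr (p - 1) / 2) * ennreal (w u) * indicator {\<alpha><..<\<beta>} u = (\<integral>\<^sup>+x. k x u \<partial>lborel)"
    proof (cases "\<alpha> < u \<and> u < \<beta>")
      case True
      have "(\<integral>\<^sup>+x. k x u \<partial>lborel) =
        (\<integral>\<^sup>+x. ennreal (t powr (p - 1) * w u / (\<beta> - u)) * indicator {u..(u + \<beta>) / 2} x \<partial>lborel)"
        using True by (intro nn_integral_cong) (auto simp: k_def)
      also have "\<dots> = ennreal (t powr (p - 1) * w u / (\<beta> - u)) * ennreal ((u + \<beta>) / 2 - u)"
        using True by (subst nn_integral_cmult_indicator) auto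
      also have "\<dots> = ennreal (t powr (p - 1) * w u / (\<beta> - u) * ((u + \<beta>) / 2 - u))"
        using True w_pos[of u] by (intro ennreal_mult[symmetric]) auto
      also have "t powr (p - 1) * w u / (\<beta> - u) * ((u + \<beta>) / 2 - u) = t powr (p - 1) / 2 * w u"
        using True by (simp add: field_simps)
      finally show ?thesis
        using True w_pos[of u] by (simp add: ennreal_mult[symmetric])
    qed (auto simp: k_def)
  qed
  also have "\<dots> = (\<integral>\<^sup>+x. (\<integral>\<^sup>+u. k x u \<partial>lborel) \<partial>lborel)"
    by (rule lborel_pair.Fubini') simp
  also have "\<dots> \<le> (\<integral>\<^sup>+x\<in>{\<alpha><..<\<beta>}. ennreal (A * G x powr (p - 1)) \<partial>lborel)"
  proof (intro nn_integral_mono)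
    fix x
    show "(\<integral>\<^sup>+u. k x u \<partial>lborel) \<le> ennreal (A * G x powr (p - 1)) * indicator {\<alpha><..<\<beta>} x"
    proof (cases "\<alpha> < x \<and> x < \<beta>")
      case True
      \<comment> \<open>For fixed x, the condition x \<le> (u + \<beta>)/2 says 2x - \<beta> \<le>
        u, so u runs through the left window of \<open>average_w_le\<close>.\<close>
      have "(\<integral>\<^sup>+u. k x u \<partial>lborel) \<le>
        (\<integral>\<^sup>+u\<in>{2 * x - \<beta>..x}. ennreal (t powr (p - 1) / (\<beta> - x) * w u) \<partial>lborel)"
      proof (intro nn_integral_mono)
        fix u
        have "t powr (p - 1) * w u / (\<beta> - u) \<le> t powr (p - 1) / (\<beta> - x) * w u" if "u \<le> x"
        proof -
          have "t powr (p - 1) * w u / (\<beta> - u) \<le> t powr (p - 1) * w u / (\<beta> - x)"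
            using True that w_pos[of u] by (intro divide_left_mono) auto
          then show ?thesis by simp
        qed
        then show "k x u \<le> ennreal (t powr (p - 1) / (\<beta> - x) * w u) * indicator {2 * x - \<beta>..x} u"
          by (auto simp: k_def intro!: ennreal_leI)
      qed
      also have "\<dots> = ennreal (integral {2 * x - \<beta>..x} (\<lambda>u. t powr (p - 1) / (\<beta> - x) * w u))"
        using True w_pos by (intro nn_integral_Icc integrable_on_mult_right w_int) (auto simp: less_imp_le)
      also have "\<dots> \<le> ennreal (A * G x powr (p - 1))"
        using average_w_le[OF t sub \<beta>] True by (intro ennreal_leI) simp
      finally show ?thesis using True by simp
    next
      case False
      then have "k x u = 0" for u by (auto simp: k_def)
      then show ?thesis by simp
    qed
  qed
  finally show ?thesis .
qed

lemma weak_type_weighted: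
  assumes t: "0 \<le> t"
  shows "ennreal (t powr (p - 1)) * (\<integral>\<^sup>+x\<in>{x. t < X x}. ennreal (w x) \<partial>lborel)
    \<le> (\<integral>\<^sup>+x\<in>{x. t < X x}. ennreal (2 * A * G x powr (p - 1)) \<partial>lborel)"
proof -
  let ?U = "{x. t < X x}"
  have [measurable]: "?U \<in> sets borel" using X.open_level[OF t] by simp
  have "(\<integral>\<^sup>+x\<in>?U. ennreal (t powr (p - 1) / 2) * ennreal (w x) \<partial>lborel)
    \<le> (\<integral>\<^sup>+x\<in>?U. ennreal (A * G x powr (p - 1)) \<partial>lborel)"
  proof (rule nn_integral_open_le_by_components)
    show "bounded ?U"
      using bounded_subset[OF _ X.level_subset[OF t]] by simp
  qed (use t X.open_level weak_type_component in auto)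
  then have "ennreal 2 * (\<integral>\<^sup>+x\<in>?U. ennreal (t powr (p - 1) / 2) * ennreal (w x) \<partial>lborel)
    \<le> ennreal 2 * (\<integral>\<^sup>+x\<in>?U. ennreal (A * G x powr (p - 1)) \<partial>lborel)"
    by (rule mult_left_mono) simp
  also have "ennreal 2 * (\<integral>\<^sup>+x\<in>?U. ennreal (A * G x powr (p - 1)) \<partial>lborel)
    = (\<integral>\<^sup>+x\<in>?U. ennreal (2 * A * G x powr (p - 1)) \<partial>lborel)"
    using A_nonneg
    by (subst nn_integral_cmult[symmetric]) (auto intro!: nn_integral_cong simp: ennreal_mult mult_ac)
  also have "ennreal 2 * (\<integral>\<^sup>+x\<in>?U. ennreal (t powr (p - 1) / 2) * ennreal (w x) \<partial>lborel)
    = (\<integral>\<^sup>+x. ennreal 2 * (ennreal (t powr (p - 1) / 2) * ennreal (w x) * indicator ?U x) \<partial>lborel)"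
    by (rule nn_integral_cmult[symmetric]) measurable
  also have "\<dots> = (\<integral>\<^sup>+x. ennreal (t powr (p - 1)) * (ennreal (w x) * indicator ?U x) \<partial>lborel)"
  proof (intro nn_integral_cong)
    fix x
    have "ennreal 2 * ennreal (t powr (p - 1) / 2) = ennreal (t powr (p - 1))"
      by (subst ennreal_mult[symmetric]) auto
    then show "ennreal 2 * (ennreal (t powr (p - 1) / 2) * ennreal (w x) * indicator ?U x)
      = ennreal (t powr (p - 1)) * (ennreal (w x) * indicator ?U x)"
      by (simp add: mult.assoc[symmetric])
  qed
  also have "\<dots> = ennreal (t powr (p - 1)) * (\<integral>\<^sup>+x\<in>?U. ennreal (w x) \<partial>lborel)"
    by (rule nn_integral_cmult) measurable
  finally show ?thesis .
qed

text \<open>In both applications of Doob's argument the weights match by duality. For v = w,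
  \<alpha> = p - 1 and u = 2 A G^(p-1), the term (u/w)^p' w is (2 A)^p' G^p s, because w^(1-p') = s.
  For v = s, \<alpha> = 1 and u = f, the term (f/s)^p s is f^p w, because s^(1-p) = w.\<close>

lemma strong_type_weighted:
  "(\<integral>\<^sup>+x. ennreal (X x powr p) * ennreal (w x) \<partial>lborel)
    \<le> ennreal ((2 * p * A) powr conj_exp p * conj_exp p powr p)
      * (\<integral>\<^sup>+x. ennreal (f x powr p) * ennreal (w x) \<partial>lborel)"
proof -
  have conj: "conj_exp p = p / (p - 1)" "0 < conj_exp p"
    using p by (auto simp: conj_exp_def)
  have conj_mult: "(1 - conj_exp p) * (1 - p) = 1"
    using p by (simp add: conj field_simps)
  have "(\<integral>\<^sup>+x\<in>{x. 0 < X x}. ennreal (w x) \<partial>lborel) \<le> (\<integral>\<^sup>+x\<in>{a..b}. ennreal (w x) \<partial>lborel)"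
    using X.level_subset[of 0] by (intro nn_integral_mono) (auto split: split_indicator)
  also have "\<dots> < \<infinity>"
    using nn_integral_Icc[OF w_int] w_pos by (simp add: less_imp_le)
  finally have fin: "(\<integral>\<^sup>+x\<in>{x. 0 < X x}. ennreal (w x) \<partial>lborel) < \<infinity>" .
  have "(\<integral>\<^sup>+x. ennreal (G x powr p) * ennreal (s x) \<partial>lborel)
    \<le> ennreal (conj_exp p powr p) * (\<integral>\<^sup>+x. ennreal ((f x / s x) powr p) * ennreal (s x) \<partial>lborel)"
    using G.strong_type_quotient_max[OF p] by (simp add: conj)
  also have "(\<integral>\<^sup>+x. ennreal ((f x / s x) powr p) * ennreal (s x) \<partial>lborel)
    = (\<integral>\<^sup>+x. ennreal (f x powr p) * ennreal (w x) \<partial>lborel)"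
  proof (intro nn_integral_cong)
    fix x
    have "(f x / s x) powr p * s x = f x powr p * (s x powr (1 - p))"
      using s_pos[of x] by (simp add: powr_divide powr_diff)
    also have "s x powr (1 - p) = w x"
      using w_pos[of x] by (simp add: s_eq powr_powr conj_mult)
    finally show "ennreal ((f x / s x) powr p) * ennreal (s x) = ennreal (f x powr p) * ennreal (w x)"
      using w_pos[of x] s_pos[of x] by (simp add: ennreal_mult[symmetric] less_imp_le)
  qed
  finally have G_le: "(\<integral>\<^sup>+x. ennreal (G x powr p) * ennreal (s x) \<partial>lborel)
    \<le> ennreal (conj_exp p powr p) * (\<integral>\<^sup>+x. ennreal (f x powr p) * ennreal (w x) \<partial>lborel)" .
  \<comment> \<open>Doob's constant for \<alpha> = p - 1; as \<open>p - (p - 1)\<close> is 1, it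
    equals p^p'.\<close>
  have "(\<integral>\<^sup>+x. ennreal (X x powr p) * ennreal (w x) \<partial>lborel)
    \<le> ennreal ((p / (p - (p - 1))) powr (p / (p - 1))) *
      (\<integral>\<^sup>+x. ennreal ((2 * A * G x powr (p - 1) / w x) powr (p / (p - 1))) * ennreal (w x) \<partial>lborel)"
    using p fin X.quotient_max_nonneg X.quotient_max_le weak_type_weighted w_pos A_nonneg
    by (intro nn_integral_powr_le_of_weak_type[OF lborel.sigma_finite_measure_axioms, where K = K])
      (auto simp: less_imp_le)
  also have "(\<integral>\<^sup>+x. ennreal ((2 * A * G x powr (p - 1) / w x) powr (p / (p - 1))) * ennreal (w x) \<partial>lborel)
    = (\<integral>\<^sup>+x. ennreal ((2 * A) powr conj_exp p) * (ennreal (G x powr p) * ennreal (s x)) \<partial>lborel)"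
  proof (intro nn_integral_cong)
    fix x
    have "(2 * A * G x powr (p - 1) / w x) powr conj_exp p * w x
      = (2 * A * G x powr (p - 1)) powr conj_exp p * (w x / w x powr conj_exp p)"
      by (simp add: powr_divide)
    also have "\<dots> = (2 * A) powr conj_exp p * (G x powr (p - 1)) powr conj_exp p * (w x / w x powr conj_exp p)"
      by (simp only: powr_mult)
    also have "(G x powr (p - 1)) powr conj_exp p = G x powr p"
      using p by (simp add: powr_powr conj)
    also have "w x / w x powr conj_exp p = s x"
      using w_pos[of x] by (simp add: s_eq powr_diff)
    finally show "ennreal ((2 * A * G x powr (p - 1) / w x) powr (p / (p - 1))) * ennreal (w x)
      = ennreal ((2 * A) powr conj_exp p) * (ennreal (G x powr p) * ennreal (s x))"
      using w_pos[of x] s_pos[of x]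
      by (simp add: ennreal_mult[symmetric] conj(1)[symmetric] less_imp_le mult.assoc)
  qed
  also have "\<dots> = ennreal ((2 * A) powr conj_exp p) * (\<integral>\<^sup>+x. ennreal (G x powr p) * ennreal (s x) \<partial>lborel)"
    by (rule nn_integral_cmult) measurable
  also have "ennreal ((p / (p - (p - 1))) powr (p / (p - 1))) * (ennreal ((2 * A) powr conj_exp p) *
      (\<integral>\<^sup>+x. ennreal (G x powr p) * ennreal (s x) \<partial>lborel))
    \<le> ennreal ((p / (p - (p - 1))) powr (p / (p - 1))) * (ennreal ((2 * A) powr conj_exp p) *
      (ennreal (conj_exp p powr p) * (\<integral>\<^sup>+x. ennreal (f x powr p) * ennreal (w x) \<partial>lborel)))"
    by (intro mult_left_mono G_le) auto
  also have "ennreal ((p / (p - (p - 1))) powr (p / (p - 1))) * (ennreal ((2 * A) powr conj_exp p) *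
      (ennreal (conj_exp p powr p) * (\<integral>\<^sup>+x. ennreal (f x powr p) * ennreal (w x) \<partial>lborel)))
    = ennreal (p powr conj_exp p * (2 * A) powr conj_exp p * conj_exp p powr p)
      * (\<integral>\<^sup>+x. ennreal (f x powr p) * ennreal (w x) \<partial>lborel)"
    by (simp add: ennreal_mult mult.assoc conj(1)[symmetric])
  also have "p powr conj_exp p * (2 * A) powr conj_exp p = (2 * p * A) powr conj_exp p"
    by (simp add: powr_mult[symmetric] mult_ac)
  finally show ?thesis .
qed

end

section \<open>Removal of the truncation\<close>

lemma ennreal_powr_ennreal [simp]: "0 \<le> x \<Longrightarrow> ennreal_powr (ennreal x) a = ennreal (x powr a)"
  by (simp add: ennreal_powr_def)

lemma ennreal_powr_top [simp]: "ennreal_powr top a = top"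
  by (simp add: ennreal_powr_def)

lemma ennreal_powr_mono:
  assumes "x \<le> y" "0 \<le> a"
  shows "ennreal_powr x a \<le> ennreal_powr y a"
proof (cases y)
  case (real r)
  then obtain q where "x = ennreal q" "0 \<le> q" "q \<le> r"
    using assms(1) by (cases x) (auto simp: top_unique)
  then show ?thesis
    using real assms(2) by (simp add: powr_mono2 ennreal_leI)
qed simp

text \<open>Continuity from below, by inverting the power: a finite bound r for all
  \<open>u i powr a\<close> gives \<open>u i \<le> r powr (1 / a)\<close>.\<close>

lemma ennreal_powr_SUP_le:
  assumes "\<And>i. 0 \<le> u i" "0 < a"
  shows "ennreal_powr (SUP i. ennreal (u i)) a \<le> (SUP i. ennreal (u i powr a))"
proof (cases "SUP i. ennreal (u i powr a)")
  case (real r)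
  have "u i \<le> r powr (1 / a)" for i
  proof -
    have "ennreal (u i powr a) \<le> ennreal r"
      unfolding real(2)[symmetric] by (rule SUP_upper) simp
    then have "(u i powr a) powr (1 / a) \<le> r powr (1 / a)"
      using real(1) assms by (intro powr_mono2) auto
    then show ?thesis using assms by (simp add: powr_powr)
  qed
  then have "ennreal_powr (SUP i. ennreal (u i)) a \<le> ennreal_powr (ennreal (r powr (1 / a))) a"
    using assms by (intro ennreal_powr_mono SUP_least ennreal_leI) auto
  also have "\<dots> = ennreal r"
    using real assms by (simp add: powr_powr)
  finally show ?thesis using real by simp
next
  case top
  then show ?thesis by (simp only: top_greatest)
qed

lemma maximal_plus_cong_AE:
  assumes "AE x in lebesgue. \<bar>f x\<bar> = \<bar>g x\<bar>"
  shows "maximal_plus f = maximal_plus g"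
  unfolding maximal_plus_def using assms
  by (intro ext SUP_cong refl arg_cong2[where f="(*)"] nn_integral_cong_AE) (auto elim!: AE_mp)

context Ap_plus_weight
begin

text \<open>The factor min 1 s yields both bounds of \<open>Ap_plus_bounded\<close> with
  \<open>K\<close> = n, and its positivity makes the truncations reach f at every point.\<close>

definition truncation :: "(real \<Rightarrow> real) \<Rightarrow> nat \<Rightarrow> real \<Rightarrow> real" where
  "truncation f n x = min (f x) (real n * min 1 (s x))"

definition truncated_max :: "(real \<Rightarrow> real) \<Rightarrow> nat \<Rightarrow> real \<Rightarrow> real" where
  "truncated_max f n = quotient_max (- real n) (real n) (truncation f n) (\<lambda>_. 1)"

lemma truncation_mono: "n \<le> m \<Longrightarrow> truncation f n x \<le> truncation f m x"
  using s_pos[of x] unfolding truncation_def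
  by (intro min.mono order_refl mult_right_mono) auto

lemma truncation_le: "truncation f n x \<le> f x"
  by (simp add: truncation_def)

lemma SUP_truncation: 
  assumes "0 \<le> f x"
  shows "(SUP n. ennreal (truncation f n x)) = ennreal (f x)"
proof (rule antisym)
  obtain n where "f x / min 1 (s x) \<le> real n"
    using real_arch_simple by blast
  then have "truncation f n x = f x"
    using s_pos[of x] by (simp add: truncation_def field_simps)
  then show "ennreal (f x) \<le> (SUP n. ennreal (truncation f n x))"
    by (metis SUP_upper UNIV_I)
qed (auto intro!: SUP_least ennreal_leI truncation_le)

context
  fixes f :: "real \<Rightarrow> real"
  assumes f_meas [measurable]: "f \<in> borel_measurable borel" and f_nonneg: "\<And>x. 0 \<le> f x"
begin

lemma truncation_meas [measurable]: "truncation f n \<in> borel_measurable borel"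
  unfolding truncation_def by measurable

text \<open>The interval is still free here; each interpretation below takes (-n, n).\<close>

lemma Ap_plus_bounded_truncation:
  "Ap_plus_bounded p A w s (real n) (truncation f n)"
proof unfold_locales
  show "truncation f n \<in> borel_measurable borel" by measurable
  show "0 \<le> truncation f n x" for x
    using f_nonneg[of x] s_pos[of x] by (simp add: truncation_def)
  show "truncation f n x \<le> real n" for x
    using mult_left_mono[of "min 1 (s x)" 1 "real n"] unfolding truncation_def
    by (intro min.coboundedI2) auto
  show "truncation f n x \<le> real n * s x" for x
    unfolding truncation_def by (intro min.coboundedI2 mult_left_mono) auto
qed

lemma truncated_max_nonneg: "0 \<le> truncated_max f n x"
proof -
  interpret Ap_plus_bounded p A w s "- real n" "real n" "real n" "truncation f n"
    by (rule Ap_plus_bounded_truncation)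
  show ?thesis
    unfolding truncated_max_def by (rule X.quotient_max_nonneg)
qed

lemma truncated_max_meas [measurable]: "truncated_max f n \<in> borel_measurable borel"
proof -
  interpret Ap_plus_bounded p A w s "- real n" "real n" "real n" "truncation f n"
    by (rule Ap_plus_bounded_truncation)
  show ?thesis
    unfolding truncated_max_def by (rule X.quotient_max_measurable)
qed

lemma average_truncation_le:
  assumes "- real n < x" "x < y" "y \<le> real n"
  shows "integral {x..y} (truncation f n) / (y - x) \<le> truncated_max f n x"
proof -
  interpret Ap_plus_bounded p A w s "- real n" "real n" "real n" "truncation f n"
    by (rule Ap_plus_bounded_truncation)
  show ?thesis
    using X.quotient_le_quotient_max[OF assms] assms by (simp add: truncated_max_def)
qed

lemma truncation_int: "truncation f n integrable_on {x..y}"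
proof (rule integrable_on_Icc_dominated)
  interpret Ap_plus_bounded p A w s "- real n" "real n" "real n" "truncation f n"
    by (rule Ap_plus_bounded_truncation)
  show "truncation f n t \<le> real n" "0 \<le> truncation f n t" for t
    using f_le_const f_nonneg by auto
qed auto

text \<open>Passing from n to n + 1 admits more endpoints y and enlarges every average; a point
  outside (-n, n) starts from the value 0.\<close>

lemma incseq_truncated_max: "incseq (\<lambda>n. truncated_max f n x)"
proof (rule incseq_SucI)
  fix n
  show "truncated_max f n x \<le> truncated_max f (Suc n) x"
  proof (cases "x \<in> {- real n<..<real n}")
    case True
    have "truncated_max f n x = (SUP y\<in>{x<..real n}. integral {x..y} (truncation f n) / (y - x))"
      using True by (auto simp: truncated_max_def quotient_max_def intro!: SUP_cong)
    also have "\<dots> \<le> truncated_max f (Suc n) x"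
    proof (rule cSUP_least)
      fix y assume y: "y \<in> {x<..real n}"
      have "integral {x..y} (truncation f n) / (y - x) \<le> integral {x..y} (truncation f (Suc n)) / (y - x)"
        using y by (intro divide_right_mono integral_le truncation_int truncation_mono) auto
      also have "\<dots> \<le> truncated_max f (Suc n) x"
        using y True by (intro average_truncation_le) auto
      finally show "integral {x..y} (truncation f n) / (y - x) \<le> truncated_max f (Suc n) x" .
    qed (use True in auto)
    finally show ?thesis .
  next
    case False
    then have "truncated_max f n x = 0" by (auto simp: truncated_max_def quotient_max_def)
    then show ?thesis using truncated_max_nonneg by simp
  qed
qed

text \<open>By monotone convergence an average of f over a fixed window is the limit of those of its
  truncations, and each of these is dominated by a competitor in \<open>truncated_max\<close> with a
  large index.\<close>

lemma maximal_plus_le_SUP: "maximal_plus f x \<le> (SUP n. ennreal (truncated_max f n x))"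
  unfolding maximal_plus_def
proof (rule SUP_least)
  fix h :: real assume "h \<in> {0<..}"
  then have h: "0 < h" by simp
  have "(\<integral>\<^sup>+t\<in>{x..x + h}. ennreal \<bar>f t\<bar> \<partial>lebesgue)
    = (\<integral>\<^sup>+t. (SUP n. ennreal (truncation f n t) * indicator {x..x + h} t) \<partial>lborel)"
    unfolding nn_integral_completion
    by (intro nn_integral_cong) (simp add: SUP_mult_right_ennreal[symmetric] SUP_truncation f_nonneg)
  also have "\<dots> = (SUP n. \<integral>\<^sup>+t\<in>{x..x + h}. ennreal (truncation f n t) \<partial>lborel)"
    by (intro nn_integral_monotone_convergence_SUP)
      (auto simp: incseq_def le_fun_def intro!: mult_right_mono ennreal_leI truncation_mono)
  finally have "ennreal (1 / h) * (\<integral>\<^sup>+t\<in>{x..x + h}. ennreal \<bar>f t\<bar> \<partial>lebesgue)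
    = (SUP n. ennreal (1 / h) * (\<integral>\<^sup>+t\<in>{x..x + h}. ennreal (truncation f n t) \<partial>lborel))"
    by (simp add: SUP_mult_left_ennreal)
  also have "\<dots> \<le> (SUP n. ennreal (truncated_max f n x))"
  proof (rule SUP_mono)
    fix n
    \<comment> \<open>The index is at least the truncation level n and so large that (-m, m)
      contains the window [x, x + h].\<close>
    obtain m where m: "max (real n) (max (\<bar>x\<bar> + 1) (\<bar>x + h\<bar> + 1)) \<le> real m"
      using real_arch_simple by blast
    have "(\<integral>\<^sup>+t\<in>{x..x + h}. ennreal (truncation f n t) \<partial>lborel)
      \<le> (\<integral>\<^sup>+t\<in>{x..x + h}. ennreal (truncation f m t) \<partial>lborel)"
      using m by (intro nn_integral_mono mult_right_mono ennreal_leI truncation_mono) auto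
    also have "\<dots> = ennreal (integral {x..x + h} (truncation f m))"
      using f_nonneg s_pos by (intro nn_integral_Icc truncation_int) (auto simp: truncation_def less_imp_le)
    finally have "ennreal (1 / h) * (\<integral>\<^sup>+t\<in>{x..x + h}. ennreal (truncation f n t) \<partial>lborel)
      \<le> ennreal (1 / h) * ennreal (integral {x..x + h} (truncation f m))"
      by (rule mult_left_mono) simp
    also have "\<dots> = ennreal (integral {x..x + h} (truncation f m) / h)"
      using h by (subst ennreal_mult'[symmetric]) auto
    also have "\<dots> \<le> ennreal (truncated_max f m x)"
      using average_truncation_le[of m x "x + h"] h m by (intro ennreal_leI) auto
    finally show "\<exists>m\<in>UNIV. ennreal (1 / h) * (\<integral>\<^sup>+t\<in>{x..x + h}. ennreal (truncation f n t) \<partial>lborel)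
      \<le> ennreal (truncated_max f m x)"
      by blast
  qed
  finally show "ennreal (1 / h) * (\<integral>\<^sup>+t\<in>{x..x + h}. ennreal \<bar>f t\<bar> \<partial>lebesgue)
    \<le> (SUP n. ennreal (truncated_max f n x))" .
qed

text \<open>The bound for truncations has a constant free of n, so monotone convergence carries it
  over to the supremum.\<close>

lemma maximal_plus_strong_type:
  "(\<integral>\<^sup>+x. ennreal_powr (maximal_plus f x) p * ennreal (w x) \<partial>lborel)
    \<le> ennreal ((2 * p * A) powr conj_exp p * conj_exp p powr p)
      * (\<integral>\<^sup>+x. ennreal (f x powr p) * ennreal (w x) \<partial>lborel)"
proof -
  have "(\<integral>\<^sup>+x. ennreal_powr (maximal_plus f x) p * ennreal (w x) \<partial>lborel)
    \<le> (\<integral>\<^sup>+x. (SUP n. ennreal (truncated_max f n x powr p) * ennreal (w x)) \<partial>lborel)"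
  proof (intro nn_integral_mono)
    fix x
    have "ennreal_powr (maximal_plus f x) p \<le> (SUP n. ennreal (truncated_max f n x powr p))"
      using p by (intro order_trans[OF ennreal_powr_mono[OF maximal_plus_le_SUP] ennreal_powr_SUP_le]
        truncated_max_nonneg) auto
    then show "ennreal_powr (maximal_plus f x) p * ennreal (w x)
      \<le> (SUP n. ennreal (truncated_max f n x powr p) * ennreal (w x))"
      by (simp add: SUP_mult_right_ennreal[symmetric] mult_right_mono)
  qed
  also have "\<dots> = (SUP n. \<integral>\<^sup>+x. ennreal (truncated_max f n x powr p) * ennreal (w x) \<partial>lborel)"
    using incseq_truncated_max p truncated_max_nonneg
    by (intro nn_integral_monotone_convergence_SUP)
      (auto simp: incseq_def le_fun_def intro!: mult_right_mono ennreal_leI powr_mono2)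
  also have "\<dots> \<le> ennreal ((2 * p * A) powr conj_exp p * conj_exp p powr p)
      * (\<integral>\<^sup>+x. ennreal (f x powr p) * ennreal (w x) \<partial>lborel)"
  proof (rule SUP_least)
    fix n
    interpret T: Ap_plus_bounded p A w s "- real n" "real n" "real n" "truncation f n"
      by (rule Ap_plus_bounded_truncation)
    have "(\<integral>\<^sup>+x. ennreal (truncated_max f n x powr p) * ennreal (w x) \<partial>lborel)
      \<le> ennreal ((2 * p * A) powr conj_exp p * conj_exp p powr p)
      * (\<integral>\<^sup>+x. ennreal (truncation f n x powr p) * ennreal (w x) \<partial>lborel)"
      using T.strong_type_weighted by (simp add: truncated_max_def)
    also have "\<dots> \<le> ennreal ((2 * p * A) powr conj_exp p * conj_exp p powr p)
      * (\<integral>\<^sup>+x. ennreal (f x powr p) * ennreal (w x) \<partial>lborel)"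
      using p T.f_nonneg truncation_le
      by (intro mult_left_mono nn_integral_mono mult_right_mono ennreal_leI powr_mono2) auto
    finally show "(\<integral>\<^sup>+x. ennreal (truncated_max f n x powr p) * ennreal (w x) \<partial>lborel)
      \<le> ennreal ((2 * p * A) powr conj_exp p * conj_exp p powr p)
      * (\<integral>\<^sup>+x. ennreal (f x powr p) * ennreal (w x) \<partial>lborel)" .
  qed
  finally show ?thesis .
qed

end
end

section \<open>Borel representatives and the bound for the operator norm\<close>

text \<open>Norms and characteristics see a weight only up to null sets, while
  \<open>Ap_plus_weight\<close> wants a Borel function that is positive at every point. The value 1
  on the exceptional set is arbitrary.\<close>

lemma weight_borel_version:
  assumes "weight w"
  obtains v where "v \<in> borel_measurable borel" "\<And>x. 0 < v x" "AE x in lebesgue. w x = v x"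
proof -
  obtain g where g: "g \<in> borel_measurable lborel" "AE x in lborel. w x = g x"
    using assms completion_ex_borel_measurable_real[of w lborel] by (auto simp: weight_def)
  have [measurable]: "g \<in> borel_measurable borel" using g(1) by simp
  define v where "v = (\<lambda>x. if 0 < g x then g x else 1)"
  have "AE x in lebesgue. 0 < w x" using assms by (simp add: weight_def)
  moreover have "AE x in lebesgue. w x = g x" using g(2) by (rule AE_completion)
  ultimately have "AE x in lebesgue. w x = v x"
    by eventually_elim (auto simp: v_def)
  moreover have "v \<in> borel_measurable borel" unfolding v_def by measurable
  ultimately show ?thesis by (intro that[of v]) (auto simp: v_def)
qed

lemma nonneg_borel_version:
  fixes f :: "real \<Rightarrow> real"
  assumes "f \<in> borel_measurable lebesgue"
  obtains g where "g \<in> borel_measurable borel" "\<And>x. 0 \<le> g x" "AE x in lebesgue. \<bar>f x\<bar> = g x"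
proof -
  obtain h where h: "h \<in> borel_measurable lborel" "AE x in lborel. f x = h x"
    using assms completion_ex_borel_measurable_real[of f lborel] by auto
  have "AE x in lebesgue. f x = h x" using h(2) by (rule AE_completion)
  then have "AE x in lebesgue. \<bar>f x\<bar> = \<bar>h x\<bar>" by eventually_elim simp
  then show ?thesis using h(1) by (intro that[of "\<lambda>x. \<bar>h x\<bar>"]) auto
qed

lemma set_nn_integral_cong_AE:
  assumes "AE x in M. f x = g x"
  shows "(\<integral>\<^sup>+x\<in>S. f x \<partial>M) = (\<integral>\<^sup>+x\<in>S. g x \<partial>M)"
  using assms by (intro nn_integral_cong_AE) (auto elim!: AE_mp)

lemma weight_integrable_on:
  assumes "weight w" "v \<in> borel_measurable borel" "\<And>x. 0 < v x" "AE x in lebesgue. w x = v x"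
  shows "v integrable_on {x..y}"
proof (rule integrable_on_Icc_of_nn_integral)
  have "set_integrable lebesgue {x..y} w"
    using assms(1) by (simp add: weight_def)
  then have "(\<integral>\<^sup>+t. ennreal (norm (indicator {x..y} t *\<^sub>R w t)) \<partial>lebesgue) < \<infinity>"
    unfolding set_integrable_def by (simp add: integrable_iff_bounded)
  also have "(\<integral>\<^sup>+t. ennreal (norm (indicator {x..y} t *\<^sub>R w t)) \<partial>lebesgue)
    = (\<integral>\<^sup>+t\<in>{x..y}. ennreal (v t) \<partial>lebesgue)"
  proof (rule nn_integral_cong_AE)
    show "AE t in lebesgue. ennreal (norm (indicator {x..y} t *\<^sub>R w t)) = ennreal (v t) * indicator {x..y} t"
      using assms(4)
    proof eventually_elim
      case (elim t)
      then show ?case using assms(3)[of t] by (simp split: split_indicator)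
    qed
  qed
  finally show "(\<integral>\<^sup>+t\<in>{x..y}. ennreal (v t) \<partial>lborel) < \<infinity>"
    unfolding nn_integral_completion .
qed (use assms in \<open>auto simp: less_imp_le\<close>)

lemma Ap_plus_char_cong_AE:
  assumes "AE x in lebesgue. w x = v x"
  shows "Ap_plus_char p w = Ap_plus_char p v"
proof -
  have "(\<integral>\<^sup>+t\<in>S. ennreal (w t) \<partial>lebesgue) = (\<integral>\<^sup>+t\<in>S. ennreal (v t) \<partial>lebesgue)" for S
    by (rule set_nn_integral_cong_AE) (use assms in \<open>auto elim!: AE_mp\<close>)
  moreover have "(\<integral>\<^sup>+t\<in>S. ennreal (w t powr (1 - conj_exp p)) \<partial>lebesgue)
    = (\<integral>\<^sup>+t\<in>S. ennreal (v t powr (1 - conj_exp p)) \<partial>lebesgue)" for S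
    by (rule set_nn_integral_cong_AE) (use assms in \<open>auto elim!: AE_mp\<close>)
  ultimately show ?thesis
    unfolding Ap_plus_char_def by simp
qed

lemma Ap_plus_weight_borel_version:
  assumes p: "1 < p" and w: "w \<in> Ap_plus p" and v: "v \<in> borel_measurable borel" "\<And>x. 0 < v x"
    and wv: "AE x in lebesgue. w x = v x"
  shows "Ap_plus_weight p (enn2real (Ap_plus_char p w)) v (\<lambda>x. v x powr (1 - conj_exp p))"
proof -
  define s where "s = (\<lambda>x. v x powr (1 - conj_exp p))"
  have [measurable]: "v \<in> borel_measurable borel" by fact
  have [measurable]: "s \<in> borel_measurable borel" unfolding s_def by measurable
  have s: "0 < s x" for x using v(2)[of x] by (simp add: s_def)
  have "weight w" and fin: "Ap_plus_char p w < \<infinity>"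
    using w by (auto simp: Ap_plus_def)
  have v_int: "v integrable_on {x..y}" for x y
    using weight_integrable_on[OF \<open>weight w\<close> v wv] .
  have char: "(ennreal (1 / h) * (\<integral>\<^sup>+t\<in>{x - h..x}. ennreal (v t) \<partial>lborel)) *
     ennreal_powr (ennreal (1 / h) * (\<integral>\<^sup>+t\<in>{x..x + h}. ennreal (s t) \<partial>lborel)) (p - 1) \<le> Ap_plus_char p w"
    (is "?F x h \<le> _") if h: "0 < h" for x h
  proof -
    have "?F x h \<le> (SUP h\<in>{0<..}. ?F x h)"
      using h by (intro SUP_upper) auto
    also have "\<dots> \<le> (SUP x. SUP h\<in>{0<..}. ?F x h)"
      by (intro SUP_upper) auto
    finally show ?thesis
      unfolding Ap_plus_char_cong_AE[OF wv] unfolding Ap_plus_char_def nn_integral_completion s_def .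
  qed
  have s_int: "s integrable_on {x..y}" for x y
  proof (cases "x < y")
    case True
    define h where "h = y - x"
    have h: "0 < h" using True by (simp add: h_def)
    have pos: "0 < integral {x - h..x} v"
      using h by (intro integral_Icc_pos v_int v) auto
    have v_eq: "(\<integral>\<^sup>+t\<in>{x - h..x}. ennreal (v t) \<partial>lborel) = ennreal (integral {x - h..x} v)"
      using v(2) by (intro nn_integral_Icc v_int) (simp add: less_imp_le)
    \<comment> \<open>For the step h = y - x the right window of the characteristic is [x, y]. An
      infinite integral of \<open>s\<close> there would be multiplied by the positive average of
      \<open>v\<close> to the left of x, making the characteristic infinite.\<close>
    have "(\<integral>\<^sup>+t\<in>{x..y}. ennreal (s t) \<partial>lborel) \<noteq> \<infinity>"
    proof
      assume inf: "(\<integral>\<^sup>+t\<in>{x..y}. ennreal (s t) \<partial>lborel) = \<infinity>"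
      have "\<infinity> = ?F x h"
        using pos h inf unfolding v_eq by (simp add: h_def ennreal_mult_top ennreal_mult_eq_top_iff)
      with char[OF h, of x] fin show False by simp
    qed
    then show ?thesis
      using s by (intro integrable_on_Icc_of_nn_integral) (auto simp: less_imp_le less_top)
  next
    case False
    then consider "y < x" | "y = x" by linarith
    then show ?thesis using integrable_on_refl[of s x] by cases auto
  qed
  have "(integral {x - h..x} v / h) * (integral {x..x + h} s / h) powr (p - 1)
    \<le> enn2real (Ap_plus_char p w)" if h: "0 < h" for x h
  proof -
    define a b where "a = integral {x - h..x} v" and "b = integral {x..x + h} s"
    have ab: "0 \<le> a" "0 \<le> b"
      unfolding a_def b_def using v(2) s
      by (auto intro!: integral_nonneg v_int s_int simp: less_imp_le)
    have eq: "(\<integral>\<^sup>+t\<in>{x - h..x}. ennreal (v t) \<partial>lborel) = ennreal a"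
      "(\<integral>\<^sup>+t\<in>{x..x + h}. ennreal (s t) \<partial>lborel) = ennreal b"
      unfolding a_def b_def using v(2) s
      by (auto intro!: nn_integral_Icc v_int s_int simp: less_imp_le)
    have "ennreal ((a / h) * (b / h) powr (p - 1)) \<le> Ap_plus_char p w"
      using char[OF h, of x] h ab
      by (simp add: eq ennreal_mult[symmetric])
    then have "enn2real (ennreal ((a / h) * (b / h) powr (p - 1))) \<le> enn2real (Ap_plus_char p w)"
      using fin by (intro enn2real_mono) auto
    then show ?thesis using ab h by (simp add: a_def b_def)
  qed
  then show ?thesis
    using p v v_int s_int unfolding s_def by unfold_locales auto
qed

lemma Lp_norm_cong_AE:
  assumes "AE x in lebesgue. g x = h x" "AE x in lebesgue. w x = v x"
  shows "Lp_norm p w g = Lp_norm p v h"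
  unfolding Lp_norm_def using assms
  by (intro arg_cong2[where f=ennreal_powr] nn_integral_cong_AE refl) (auto elim!: AE_mp)

lemma op_norm_maximal_plus_le:
  assumes p: "1 < p" and w: "w \<in> Ap_plus p"
  shows "op_norm p w maximal_plus \<le>
    ennreal ((2 * p) powr (1 / (p - 1)) * conj_exp p) * ennreal_powr (Ap_plus_char p w) (1 / (p - 1))"
proof -
  define A where "A = enn2real (Ap_plus_char p w)"
  define C where "C = (2 * p * A) powr conj_exp p * conj_exp p powr p"
  have A: "0 \<le> A" "Ap_plus_char p w = ennreal A"
    using w by (auto simp: A_def Ap_plus_def)
  obtain v where v: "v \<in> borel_measurable borel" "\<And>x. 0 < v x" "AE x in lebesgue. w x = v x"
    using w weight_borel_version by (auto simp: Ap_plus_def)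
  interpret Ap_plus_weight p A v "\<lambda>x. v x powr (1 - conj_exp p)"
    unfolding A_def by (rule Ap_plus_weight_borel_version[OF p w v])
  have conj: "0 < conj_exp p" "conj_exp p / p = 1 / (p - 1)"
    using p by (auto simp: conj_exp_def)
  have C_root: "C powr (1 / p) = (2 * p) powr (1 / (p - 1)) * conj_exp p * A powr (1 / (p - 1))"
    using p A(1) conj by (simp add: C_def powr_mult powr_powr)
  have "Lp_norm p w (maximal_plus f) \<le> ennreal (C powr (1 / p))"
    if f: "f \<in> borel_measurable lebesgue" "Lp_norm p w (\<lambda>x. ennreal \<bar>f x\<bar>) \<le> 1" for f
  proof -
    obtain g where g: "g \<in> borel_measurable borel" "\<And>x. 0 \<le> g x" "AE x in lebesgue. \<bar>f x\<bar> = g x"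
      using nonneg_borel_version[OF f(1)] by blast
    have mf: "maximal_plus f = maximal_plus g"
      using g by (intro maximal_plus_cong_AE) auto
    define N where "N = (\<integral>\<^sup>+x. ennreal (g x powr p) * ennreal (v x) \<partial>lborel)"
    have "Lp_norm p w (\<lambda>x. ennreal \<bar>f x\<bar>) = Lp_norm p v (\<lambda>x. ennreal (g x))"
      using g(3) v(3) by (intro Lp_norm_cong_AE) (auto elim!: AE_mp)
    also have "\<dots> = ennreal_powr N (1 / p)"
      using g(2) by (simp add: Lp_norm_def nn_integral_completion N_def)
    finally have N1: "ennreal_powr N (1 / p) \<le> 1" using f(2) by simp
    have "N \<le> 1"
    proof (cases N)
      case (real r)
      have "r powr (1 / p) \<le> 1" using N1 real by (simp add: ennreal_le_1)
      then have "(r powr (1 / p)) powr p \<le> 1 powr p"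
        using p by (intro powr_mono2) auto
      then show ?thesis using p real by (simp add: powr_powr ennreal_le_1)
    qed (use N1 in \<open>simp add: top_unique\<close>)
    have "(\<integral>\<^sup>+x. ennreal_powr (maximal_plus g x) p * ennreal (v x) \<partial>lborel) \<le> ennreal C * N"
      unfolding C_def N_def by (rule maximal_plus_strong_type[OF g(1,2)])
    also have "\<dots> \<le> ennreal C * 1"
      by (intro mult_left_mono \<open>N \<le> 1\<close>) simp
    finally have "Lp_norm p v (maximal_plus g) \<le> ennreal_powr (ennreal C) (1 / p)"
      unfolding Lp_norm_def nn_integral_completion using p by (intro ennreal_powr_mono) auto
    moreover have "0 \<le> C" by (simp add: C_def)
    moreover have "Lp_norm p w (maximal_plus f) = Lp_norm p v (maximal_plus g)"
      using v(3) by (simp add: mf Lp_norm_cong_AE)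
    ultimately show ?thesis by simp
  qed
  then have "op_norm p w maximal_plus \<le> ennreal (C powr (1 / p))"
    unfolding op_norm_def by (intro SUP_least) auto
  then show ?thesis
    using A conj by (simp add: C_root ennreal_mult)
qed

section \<open>Power weights and sharpness of the exponent\<close>

text \<open>Arbitrary \<open>g\<close> is allowed because integrals over \<open>lebesgue\<close> are
  rewritten over \<open>lborel\<close>, where the integrand may fail to be Borel. The substitution
  rule is applied to the simple functions below \<open>g\<close>, which are Borel; the reverse
  inequality is the same one for the reflected \<open>g\<close>.\<close>

lemma nn_integral_lborel_reflect:
  fixes g :: "real \<Rightarrow> ennreal"
  shows "(\<integral>\<^sup>+x. g (- x) \<partial>lborel) = (\<integral>\<^sup>+x. g x \<partial>lborel)"
proof -
  have le: "(\<integral>\<^sup>+x. g x \<partial>lborel) \<le> (\<integral>\<^sup>+x. g (- x) \<partial>lborel)" for g :: "real \<Rightarrow> ennreal"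
  proof -
    have "integral\<^sup>S lborel h \<le> (\<integral>\<^sup>+x. g (- x) \<partial>lborel)" if h: "simple_function lborel h" "h \<le> g" for h
    proof -
      have "h \<in> borel_measurable borel"
        using borel_measurable_simple_function[OF h(1)] by simp
      then have "integral\<^sup>S lborel h = (\<integral>\<^sup>+x. h (- x) \<partial>lborel)"
        using nn_integral_real_affine[of h "-1" 0] h(1) by (simp add: nn_integral_eq_simple_integral)
      also have "\<dots> \<le> (\<integral>\<^sup>+x. g (- x) \<partial>lborel)"
        using h(2) by (intro nn_integral_mono) (auto simp: le_fun_def)
      finally show ?thesis .
    qed
    then show ?thesis
      unfolding nn_integral_def[of lborel g] by (intro SUP_least) auto
  qed
  show ?thesis
    using le[of g] le[of "\<lambda>x. g (- x)"] by simp
qed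

lemma nn_integral_abs_powr:
  assumes "0 < q" "0 \<le> r"
  shows "(\<integral>\<^sup>+t\<in>{0..r}. ennreal (\<bar>t\<bar> powr (q - 1)) \<partial>lborel) = ennreal (r powr q / q)"
    and "(\<integral>\<^sup>+t\<in>{- r..0}. ennreal (\<bar>t\<bar> powr (q - 1)) \<partial>lborel) = ennreal (r powr q / q)"
proof -
  have "((\<lambda>t. t powr (q - 1)) has_integral (r powr (q - 1 + 1) / (q - 1 + 1))) {0..r}"
    using assms by (intro has_integral_powr_from_0) auto
  then have "((\<lambda>t. \<bar>t\<bar> powr (q - 1)) has_integral (r powr q / q)) {0..r}"
    using has_integral_eq[of "{0..r}" "\<lambda>t. t powr (q - 1)" "\<lambda>t. \<bar>t\<bar> powr (q - 1)"] by simp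
  then show pos: "(\<integral>\<^sup>+t\<in>{0..r}. ennreal (\<bar>t\<bar> powr (q - 1)) \<partial>lborel) = ennreal (r powr q / q)"
    by (intro nn_integral_has_integral_lebesgue') auto
  have "(\<integral>\<^sup>+t\<in>{- r..0}. ennreal (\<bar>t\<bar> powr (q - 1)) \<partial>lborel)
    = (\<integral>\<^sup>+t. ennreal (\<bar>- t\<bar> powr (q - 1)) * indicator {- r..0} (- t) \<partial>lborel)"
    by (rule nn_integral_lborel_reflect[symmetric])
  also have "\<dots> = (\<integral>\<^sup>+t\<in>{0..r}. ennreal (\<bar>t\<bar> powr (q - 1)) \<partial>lborel)"
    by (intro nn_integral_cong) (auto split: split_indicator)
  finally show "(\<integral>\<^sup>+t\<in>{- r..0}. ennreal (\<bar>t\<bar> powr (q - 1)) \<partial>lborel) = ennreal (r powr q / q)"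
    using pos by simp
qed

lemma nn_integral_Icc_le_const:
  assumes "\<And>t. t \<in> {x..y} \<Longrightarrow> g t \<le> C" "0 \<le> C" "x \<le> y"
  shows "(\<integral>\<^sup>+t\<in>{x..y}. ennreal (g t) \<partial>lborel) \<le> ennreal (C * (y - x))"
proof -
  have "(\<integral>\<^sup>+t\<in>{x..y}. ennreal (g t) \<partial>lborel) \<le> (\<integral>\<^sup>+t. ennreal C * indicator {x..y} t \<partial>lborel)"
    using assms by (intro nn_integral_mono) (auto split: split_indicator intro: ennreal_leI)
  also have "\<dots> = ennreal (C * (y - x))"
    using assms by (subst nn_integral_cmult_indicator) (auto simp: ennreal_mult)
  finally show ?thesis .
qed

locale power_weight =
  fixes p d :: real
  assumes p: "1 < p" and d: "0 < d" "d < 1"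
begin

text \<open>The exponent is dictated by the dual weight: w^(1-p') = |x|^(d-1) is barely integrable
  at 0 for small d, with mass of order 1/d.\<close>

definition w :: "real \<Rightarrow> real" where
  "w x = \<bar>x\<bar> powr ((p - 1) * (1 - d))"

text \<open>For \<open>x < 0\<close> the average of \<open>f\<close> over \<open>[x, -x]\<close> is \<open>1 / (2 * d)\<close> times \<open>f (-x)\<close>, while \<open>w\<close> is
  even; so \<open>maximal_plus\<close> enlarges the norm of \<open>f\<close> at least by that factor.\<close>
definition f :: "real \<Rightarrow> real" where
  "f x = (if x \<in> {0..1} then d powr (1 / p) * \<bar>x\<bar> powr (d - 1) else 0)"

lemma exponent: "0 < (p - 1) * (1 - d)" "(p - 1) * (1 - d) \<le> p - 1"
  using p d by (auto simp: mult_left_le)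

lemma w_powr: "w x powr (1 - conj_exp p) = \<bar>x\<bar> powr (d - 1)"
proof -
  have "(p - 1) * (1 - d) * (1 - conj_exp p) = d - 1"
    using p by (simp add: conj_exp_def field_simps)
  then show ?thesis by (simp add: w_def powr_powr)
qed

lemma weight_w: "weight w"
proof -
  have cont: "continuous_on K w" for K
    unfolding w_def using exponent(1) by (intro continuous_on_powr' continuous_intros) auto
  have "set_integrable lebesgue K w" if "compact K" for K
  proof -
    have "integrable lborel (\<lambda>x. indicator K x *\<^sub>R w x)"
      using borel_integrable_compact[OF that cont] .
    then show ?thesis
      unfolding set_integrable_def by (subst integrable_completion) (auto dest: borel_measurable_integrable)
  qed
  moreover have "w \<in> borel_measurable lborel"
    using borel_measurable_continuous_onI[OF cont] by simp
  then have "w \<in> borel_measurable lebesgue"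
    by (rule measurable_completion)
  moreover have "AE x in lborel. x \<noteq> 0"
    by (rule AE_lborel_singleton)
  then have "AE x in lebesgue. x \<noteq> (0::real)"
    by (rule AE_completion)
  then have "AE x in lebesgue. 0 < w x"
    by eventually_elim (simp add: w_def)
  ultimately show ?thesis by (auto simp: weight_def)
qed

lemma Ap_product_le:
  assumes h: "0 < h" and W: "\<And>t. t \<in> {x - h..x} \<Longrightarrow> w t \<le> W" "0 \<le> W"
    and S: "(\<integral>\<^sup>+t\<in>{x..x + h}. ennreal (\<bar>t\<bar> powr (d - 1)) \<partial>lborel) \<le> ennreal (S * h)" "0 \<le> S"
  shows "(ennreal (1 / h) * (\<integral>\<^sup>+t\<in>{x - h..x}. ennreal (w t) \<partial>lborel)) *
     ennreal_powr (ennreal (1 / h) * (\<integral>\<^sup>+t\<in>{x..x + h}. ennreal (\<bar>t\<bar> powr (d - 1)) \<partial>lborel)) (p - 1)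
    \<le> ennreal (W * S powr (p - 1))"
proof -
  have "ennreal (1 / h) * (\<integral>\<^sup>+t\<in>{x - h..x}. ennreal (w t) \<partial>lborel) \<le> ennreal (1 / h) * ennreal (W * (x - (x - h)))"
    using h W by (intro mult_left_mono nn_integral_Icc_le_const) auto
  also have "\<dots> = ennreal W"
    using h W by (simp add: ennreal_mult[symmetric])
  finally have 1: "ennreal (1 / h) * (\<integral>\<^sup>+t\<in>{x - h..x}. ennreal (w t) \<partial>lborel) \<le> ennreal W" .
  have "ennreal (1 / h) * (\<integral>\<^sup>+t\<in>{x..x + h}. ennreal (\<bar>t\<bar> powr (d - 1)) \<partial>lborel) \<le> ennreal (1 / h) * ennreal (S * h)"
    by (intro mult_left_mono S) auto
  also have "\<dots> = ennreal S"
    using h S by (simp add: ennreal_mult[symmetric])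
  finally have "ennreal_powr (ennreal (1 / h) * (\<integral>\<^sup>+t\<in>{x..x + h}. ennreal (\<bar>t\<bar> powr (d - 1)) \<partial>lborel)) (p - 1)
    \<le> ennreal_powr (ennreal S) (p - 1)"
    using p by (intro ennreal_powr_mono) auto
  then have "ennreal_powr (ennreal (1 / h) * (\<integral>\<^sup>+t\<in>{x..x + h}. ennreal (\<bar>t\<bar> powr (d - 1)) \<partial>lborel)) (p - 1)
    \<le> ennreal (S powr (p - 1))"
    using S by simp
  from mult_mono[OF 1 this] show ?thesis
    using W S by (simp add: ennreal_mult)
qed

text \<open>If |x| \<le> 2h, both windows lie in [-3h, 3h]: \<open>w\<close> is at most its value at
  3h, the dual weight has integral at most 2 (3h)^d / d = (6/d) (3h)^(d-1) h, and the powers of 3h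
  cancel. This is the origin of the 6. If |x| > 2h, the windows avoid 0 and |t| varies on them by a
  factor of at most 3.\<close>

lemma Ap_plus_char_le: "Ap_plus_char p w \<le> ennreal ((6 / d) powr (p - 1))"
  unfolding Ap_plus_char_def nn_integral_completion w_powr
proof (intro SUP_least)
  fix x h :: real assume "h \<in> {0<..}"
  then have h: "0 < h" by simp
  show "(ennreal (1 / h) * (\<integral>\<^sup>+t\<in>{x - h..x}. ennreal (w t) \<partial>lborel)) *
     ennreal_powr (ennreal (1 / h) * (\<integral>\<^sup>+t\<in>{x..x + h}. ennreal (\<bar>t\<bar> powr (d - 1)) \<partial>lborel)) (p - 1)
    \<le> ennreal ((6 / d) powr (p - 1))" (is "?F \<le> _")
  proof (cases "\<bar>x\<bar> \<le> 2 * h")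
    case True
    have "?F \<le> ennreal ((3 * h) powr ((p - 1) * (1 - d)) * (6 / d * (3 * h) powr (d - 1)) powr (p - 1))"
    proof (rule Ap_product_le[OF h])
      show "w t \<le> (3 * h) powr ((p - 1) * (1 - d))" if "t \<in> {x - h..x}" for t
        unfolding w_def using exponent True that by (intro powr_mono2) auto
      have "(\<integral>\<^sup>+t\<in>{x..x + h}. ennreal (\<bar>t\<bar> powr (d - 1)) \<partial>lborel)
        \<le> (\<integral>\<^sup>+t. ennreal (\<bar>t\<bar> powr (d - 1)) * indicator {- (3 * h)..0} t
            + ennreal (\<bar>t\<bar> powr (d - 1)) * indicator {0..3 * h} t \<partial>lborel)"
        using True by (intro nn_integral_mono) (auto split: split_indicator)
      also have "\<dots> = ennreal ((3 * h) powr d / d) + ennreal ((3 * h) powr d / d)"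
        using nn_integral_abs_powr[of d "3 * h"] d h by (subst nn_integral_add) auto
      also have "\<dots> = ennreal (6 / d * (3 * h) powr (d - 1) * h)"
        using h d by (simp add: ennreal_plus[symmetric] powr_diff del: ennreal_plus)
      finally show "(\<integral>\<^sup>+t\<in>{x..x + h}. ennreal (\<bar>t\<bar> powr (d - 1)) \<partial>lborel)
        \<le> ennreal (6 / d * (3 * h) powr (d - 1) * h)" .
    qed (use d in auto)
    also have "(6 / d * (3 * h) powr (d - 1)) powr (p - 1) = (6 / d) powr (p - 1) * (3 * h) powr ((d - 1) * (p - 1))"
      by (simp only: powr_mult powr_powr)
    also have "(3 * h) powr ((p - 1) * (1 - d)) * ((6 / d) powr (p - 1) * (3 * h) powr ((d - 1) * (p - 1)))
      = (6 / d) powr (p - 1) * ((3 * h) powr ((p - 1) * (1 - d)) * (3 * h) powr ((d - 1) * (p - 1)))"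
      by (simp only: mult_ac)
    also have "(3 * h) powr ((p - 1) * (1 - d)) * (3 * h) powr ((d - 1) * (p - 1)) = 1"
      using h by (simp add: powr_add[symmetric] algebra_simps)
    finally show ?thesis by simp
  next
    case False
    define y where "y = \<bar>x\<bar>"
    have y: "2 * h < y" using False by (simp add: y_def)
    have "?F \<le> ennreal ((y + h) powr ((p - 1) * (1 - d)) * ((y - h) powr (d - 1)) powr (p - 1))"
    proof (rule Ap_product_le[OF h])
      show "w t \<le> (y + h) powr ((p - 1) * (1 - d))" if "t \<in> {x - h..x}" for t
        unfolding w_def using exponent that h by (intro powr_mono2) (auto simp: y_def)
      have "(\<integral>\<^sup>+t\<in>{x..x + h}. ennreal (\<bar>t\<bar> powr (d - 1)) \<partial>lborel) \<le> ennreal ((y - h) powr (d - 1) * (x + h - x))"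
        using d y h by (intro nn_integral_Icc_le_const powr_mono2') (auto simp: y_def)
      then show "(\<integral>\<^sup>+t\<in>{x..x + h}. ennreal (\<bar>t\<bar> powr (d - 1)) \<partial>lborel) \<le> ennreal ((y - h) powr (d - 1) * h)"
        by simp
    qed auto
    also have "((y - h) powr (d - 1)) powr (p - 1) = (y - h) powr - ((p - 1) * (1 - d))"
      by (simp add: powr_powr algebra_simps)
    also have "(y + h) powr ((p - 1) * (1 - d)) * (y - h) powr - ((p - 1) * (1 - d))
      = ((y + h) / (y - h)) powr ((p - 1) * (1 - d))"
      by (simp add: powr_divide powr_minus_divide)
    also have "\<dots> \<le> (6 / d) powr ((p - 1) * (1 - d))"
    proof (intro powr_mono2)
      have "(y + h) / (y - h) \<le> 3" using y h by (simp add: divide_le_eq)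
      also have "3 \<le> 6 / d" using d by (simp add: le_divide_eq)
      finally show "(y + h) / (y - h) \<le> 6 / d" .
    qed (use exponent y h in auto)
    also have "\<dots> \<le> (6 / d) powr (p - 1)"
      using exponent d by (intro powr_mono) (auto simp: le_divide_eq)
    finally show ?thesis by (simp add: ennreal_leI)
  qed
qed

text \<open>From x = 0 and h = 1, where the two averages are \<open>1 / ?\<beta>\<close> and
  \<open>1 / d\<close>. The bound is there to place the characteristic in [1, \<infinity>), the
  domain on which \<psi> is monotone.\<close>

lemma Ap_plus_char_ge: "ennreal ((1 / d) powr (p - 1) / p) \<le> Ap_plus_char p w"
proof -
  let ?\<beta> = "(p - 1) * (1 - d) + 1"
  have \<beta>: "0 < ?\<beta>" "?\<beta> \<le> p" using exponent by auto
  have "ennreal ((1 / d) powr (p - 1) / p) \<le> ennreal (1 / ?\<beta> * (1 / d) powr (p - 1))"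
    using \<beta> p d by (intro ennreal_leI) (auto intro!: divide_left_mono mult_pos_pos)
  also have "\<dots> = ennreal (1 / ?\<beta>) * ennreal_powr (ennreal (1 / d)) (p - 1)"
    using \<beta> d by (subst ennreal_mult) auto
  also have "\<dots> = (ennreal (1 / 1) * (\<integral>\<^sup>+t\<in>{0 - 1..0}. ennreal (w t) \<partial>lborel)) *
     ennreal_powr (ennreal (1 / 1) * (\<integral>\<^sup>+t\<in>{0..0 + 1}. ennreal (\<bar>t\<bar> powr (d - 1)) \<partial>lborel)) (p - 1)"
    using nn_integral_abs_powr(2)[of ?\<beta> 1] nn_integral_abs_powr(1)[of d 1] \<beta> d by (simp add: w_def)
  also have "\<dots> \<le> Ap_plus_char p w"
    unfolding Ap_plus_char_def nn_integral_completion w_powr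
    by (rule SUP_upper2[of 0], simp, rule SUP_upper2[of 1]) auto
  finally show ?thesis .
qed

lemma w_in_Ap_plus: "w \<in> Ap_plus p"
  using weight_w Ap_plus_char_le by (auto simp: Ap_plus_def intro: le_less_trans)

lemma powr_p_mult_w: "(c * \<bar>x\<bar> powr (d - 1)) powr p * w x = c powr p * \<bar>x\<bar> powr (d - 1)"
proof -
  have "(c * \<bar>x\<bar> powr (d - 1)) powr p * w x
    = c powr p * (\<bar>x\<bar> powr ((d - 1) * p) * \<bar>x\<bar> powr ((p - 1) * (1 - d)))"
    by (simp only: powr_mult powr_powr w_def mult.assoc)
  also have "\<bar>x\<bar> powr ((d - 1) * p) * \<bar>x\<bar> powr ((p - 1) * (1 - d)) = \<bar>x\<bar> powr (d - 1)"
    by (simp add: powr_add[symmetric] algebra_simps)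
  finally show ?thesis .
qed

lemma f_meas: "f \<in> borel_measurable borel"
  unfolding f_def by measurable

text \<open>The factor d^(1/p) in \<open>f\<close> is the normalisation: since (d-1) p + (p-1)(1-d)
  = d - 1, f^p w is d |x|^(d-1) on [0, 1], and |x|^(d-1) has integral 1/d there.\<close>

lemma Lp_norm_f: "Lp_norm p w (\<lambda>x. ennreal \<bar>f x\<bar>) = 1"
proof -
  have "(\<integral>\<^sup>+x. ennreal_powr (ennreal \<bar>f x\<bar>) p * ennreal (w x) \<partial>lborel)
    = (\<integral>\<^sup>+x. ennreal d * (ennreal (\<bar>x\<bar> powr (d - 1)) * indicator {0..1} x) \<partial>lborel)"
  proof (intro nn_integral_cong)
    fix x
    show "ennreal_powr (ennreal \<bar>f x\<bar>) p * ennreal (w x)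
      = ennreal d * (ennreal (\<bar>x\<bar> powr (d - 1)) * indicator {0..1} x)"
    proof (cases "x \<in> {0..1}")
      case True
      have "ennreal_powr (ennreal \<bar>f x\<bar>) p * ennreal (w x)
        = ennreal ((d powr (1 / p) * \<bar>x\<bar> powr (d - 1)) powr p * w x)"
        using True by (subst ennreal_mult) (auto simp: f_def w_def abs_mult)
      also have "\<dots> = ennreal (d * \<bar>x\<bar> powr (d - 1))"
        unfolding powr_p_mult_w using p d by (simp add: powr_powr)
      finally show ?thesis using True d by (simp add: ennreal_mult)
    next
      case False
      then have "f x = 0" by (auto simp: f_def)
      then show ?thesis using False by (simp add: ennreal_powr_def)
    qed
  qed
  also have "\<dots> = ennreal d * ennreal (1 powr d / d)"
    using d by (subst nn_integral_cmult) (auto simp: nn_integral_abs_powr)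
  also have "\<dots> = 1"
    using d by (simp add: ennreal_mult[symmetric])
  finally show ?thesis
    by (simp add: Lp_norm_def nn_integral_completion flip: ennreal_1)
qed

lemma maximal_plus_f_ge:
  assumes "x \<in> {-1..0}"
  shows "ennreal (d powr (1 / p) / (2 * d) * \<bar>x\<bar> powr (d - 1)) \<le> maximal_plus f x"
\<comment> \<open>At x = 0 the left side vanishes, because \<open>0 powr (d - 1)\<close> is
  0.\<close>
proof (cases "x = 0")
  case False
  then have x: "x < 0" "-1 \<le> x" using assms by auto
  have "d powr (1 / p) / (2 * d) * \<bar>x\<bar> powr (d - 1) = 1 / (2 * \<bar>x\<bar>) * (d powr (1 / p) * (\<bar>x\<bar> powr d / d))"
    using x by (simp add: powr_diff)
  then have "ennreal (d powr (1 / p) / (2 * d) * \<bar>x\<bar> powr (d - 1))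
    = ennreal (1 / (2 * \<bar>x\<bar>)) * (ennreal (d powr (1 / p)) * ennreal (\<bar>x\<bar> powr d / d))"
    using d by (simp only: ennreal_mult[symmetric]) (simp add: ennreal_mult[symmetric])
  moreover have "ennreal (d powr (1 / p)) * ennreal (\<bar>x\<bar> powr d / d)
    \<le> (\<integral>\<^sup>+t\<in>{x..x + 2 * \<bar>x\<bar>}. ennreal \<bar>f t\<bar> \<partial>lebesgue)"
  proof -
    have "ennreal (\<bar>x\<bar> powr d / d) = (\<integral>\<^sup>+t\<in>{0..\<bar>x\<bar>}. ennreal (\<bar>t\<bar> powr (d - 1)) \<partial>lborel)"
      using d by (simp add: nn_integral_abs_powr)
    then have "ennreal (d powr (1 / p)) * ennreal (\<bar>x\<bar> powr d / d) = ennreal (d powr (1 / p)) *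
      (\<integral>\<^sup>+t\<in>{0..\<bar>x\<bar>}. ennreal (\<bar>t\<bar> powr (d - 1)) \<partial>lborel)"
      by simp
    also have "\<dots> = (\<integral>\<^sup>+t. ennreal (d powr (1 / p)) * (ennreal (\<bar>t\<bar> powr (d - 1)) * indicator {0..\<bar>x\<bar>} t) \<partial>lborel)"
      by (rule nn_integral_cmult[symmetric]) measurable
    also have "\<dots> \<le> (\<integral>\<^sup>+t\<in>{x..x + 2 * \<bar>x\<bar>}. ennreal \<bar>f t\<bar> \<partial>lborel)"
      using x by (intro nn_integral_mono) (auto split: split_indicator simp: f_def abs_mult ennreal_mult)
    finally show ?thesis unfolding nn_integral_completion .
  qed
  ultimately have "ennreal (d powr (1 / p) / (2 * d) * \<bar>x\<bar> powr (d - 1))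
    \<le> ennreal (1 / (2 * \<bar>x\<bar>)) * (\<integral>\<^sup>+t\<in>{x..x + 2 * \<bar>x\<bar>}. ennreal \<bar>f t\<bar> \<partial>lebesgue)"
    by (simp add: mult_left_mono)
  also have "\<dots> \<le> maximal_plus f x"
    unfolding maximal_plus_def using x by (intro SUP_upper) auto
  finally show ?thesis .
qed simp

lemma Lp_norm_maximal_plus_f: "ennreal (1 / (2 * d)) \<le> Lp_norm p w (maximal_plus f)"
proof -
  let ?c = "d powr (1 / p) / (2 * d)"
  have "ennreal (?c powr p) * ennreal (1 powr d / d)
    = ennreal (?c powr p) * (\<integral>\<^sup>+x\<in>{-1..0}. ennreal (\<bar>x\<bar> powr (d - 1)) \<partial>lborel)"
    using d by (simp add: nn_integral_abs_powr)
  also have "\<dots> = (\<integral>\<^sup>+x. ennreal (?c powr p) * (ennreal (\<bar>x\<bar> powr (d - 1)) * indicator {-1..0} x) \<partial>lborel)"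
    by (rule nn_integral_cmult[symmetric]) measurable
  also have "\<dots> \<le> (\<integral>\<^sup>+x. ennreal_powr (maximal_plus f x) p * ennreal (w x) \<partial>lborel)"
  proof (intro nn_integral_mono)
    fix x
    show "ennreal (?c powr p) * (ennreal (\<bar>x\<bar> powr (d - 1)) * indicator {-1..0} x)
      \<le> ennreal_powr (maximal_plus f x) p * ennreal (w x)"
    proof (cases "x \<in> {-1..0}")
      case True
      have "ennreal (?c powr p) * ennreal (\<bar>x\<bar> powr (d - 1)) = ennreal ((?c * \<bar>x\<bar> powr (d - 1)) powr p * w x)"
        unfolding powr_p_mult_w by (rule ennreal_mult[symmetric]) auto
      also have "\<dots> = ennreal_powr (ennreal (?c * \<bar>x\<bar> powr (d - 1))) p * ennreal (w x)"
        using d by (subst ennreal_mult) (auto simp: w_def)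
      also have "\<dots> \<le> ennreal_powr (maximal_plus f x) p * ennreal (w x)"
        using p True by (intro mult_right_mono ennreal_powr_mono maximal_plus_f_ge) auto
      finally show ?thesis using True by simp
    qed auto
  qed
  \<comment> \<open>The p-th power of d^(1/p) cancels the mass 1/d of |x|^(d-1) on [-1, 0].\<close>
  also have "ennreal (?c powr p) * ennreal (1 powr d / d) = ennreal ((1 / (2 * d)) powr p)"
  proof -
    have "?c powr p = d * (1 / (2 * d)) powr p"
      using p d by (simp add: powr_divide powr_powr)
    then show ?thesis using d by (simp add: ennreal_mult[symmetric])
  qed
  finally have "ennreal_powr (ennreal ((1 / (2 * d)) powr p)) (1 / p) \<le> Lp_norm p w (maximal_plus f)"
    unfolding Lp_norm_def nn_integral_completion using p by (intro ennreal_powr_mono) auto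
  then show ?thesis
    using p d by (simp add: powr_powr)
qed

lemma op_norm_ge: "ennreal (1 / (2 * d)) \<le> op_norm p w maximal_plus"
proof -
  have "f \<in> borel_measurable lebesgue"
    using f_meas by (intro measurable_completion) simp
  then show ?thesis
    unfolding op_norm_def using Lp_norm_f Lp_norm_maximal_plus_f by (intro SUP_upper2) auto
qed

end

text \<open>The norm is at least 1/(2d) while the characteristic is at most T = (6/d)^(p-1), and
  1/(2d) is T^(1/(p-1)) / 12; hence the threshold 1/12. Monotonicity of \<psi> lets \<open>T\<close>
  stand in for the characteristic, so \<open>T\<close> can be chosen first, beyond the threshold of
  the limit, and d computed from it.\<close>

lemma exponent_sharp_plus:
  fixes \<psi> :: "real \<Rightarrow> real"
  assumes p: "1 < p" and mono: "mono_on {1..} \<psi>"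
    and lim: "((\<lambda>t. \<psi> t / t powr (1 / (p - 1))) \<longlongrightarrow> 0) at_top"
    and bound: "\<And>w. w \<in> Ap_plus p \<Longrightarrow> op_norm p w maximal_plus \<le> ennreal (\<psi> (enn2real (Ap_plus_char p w)))"
  shows False
proof -
  have "\<forall>\<^sub>F t in at_top. \<psi> t / t powr (1 / (p - 1)) < 1 / 12"
    using lim by (rule order_tendstoD) simp
  then obtain N where N: "\<And>t. N \<le> t \<Longrightarrow> \<psi> t / t powr (1 / (p - 1)) < 1 / 12"
    by (auto simp: eventually_at_top_linorder)
  \<comment> \<open>The second lower bound on \<open>T\<close> amounts to (1/d)^(p-1) \<ge> p, which
    gives both d < 1 and a characteristic of at least 1.\<close>
  define T where "T = max N (p * 6 powr (p - 1))"
  define d where "d = 6 / T powr (1 / (p - 1))"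
  have T: "N \<le> T" "p * 6 powr (p - 1) \<le> T" by (auto simp: T_def)
  have T_pos: "0 < T" using T(2) p by (smt (verit) mult_pos_pos powr_gt_zero)
  have d_pos: "0 < d" using T_pos by (simp add: d_def)
  have T_eq: "(6 / d) powr (p - 1) = T"
    using p T_pos by (simp add: d_def powr_powr)
  then have "(1 / d) powr (p - 1) * 6 powr (p - 1) = T"
    by (simp add: powr_mult[symmetric])
  then have ge_p: "p \<le> (1 / d) powr (p - 1)"
    using T(2) by (metis mult_le_cancel_right_pos powr_gt_zero zero_neq_numeral)
  have "d < 1"
  proof (rule ccontr)
    assume "\<not> d < 1"
    then have "(1 / d) powr (p - 1) \<le> 1 powr (p - 1)"
      using p d_pos by (intro powr_mono2) auto
    with ge_p p show False by simp
  qed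
  then interpret power_weight p d
    using p d_pos by unfold_locales auto
  define c where "c = enn2real (Ap_plus_char p w)"
  have char: "Ap_plus_char p w = ennreal c"
    using w_in_Ap_plus by (simp add: c_def Ap_plus_def)
  have c: "(1 / d) powr (p - 1) / p \<le> c" "c \<le> T"
  proof -
    have "0 \<le> c" by (simp add: c_def)
    then show "(1 / d) powr (p - 1) / p \<le> c"
      using Ap_plus_char_ge by (simp add: char)
    show "c \<le> T"
      using Ap_plus_char_le T_pos by (simp add: char T_eq)
  qed
  have "1 \<le> (1 / d) powr (p - 1) / p" using ge_p p by (simp add: le_divide_eq)
  then have "1 \<le> c" using c(1) by linarith
  then have "\<psi> c \<le> \<psi> T"
    using c(2) by (intro mono_onD[OF mono]) auto
  moreover have "ennreal (1 / (2 * d)) \<le> ennreal (\<psi> c)"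
    using op_norm_ge bound[OF w_in_Ap_plus] by (auto simp: c_def intro: order_trans)
  then have "1 / (2 * d) \<le> \<psi> c"
    \<comment> \<open>\<open>ennreal\<close> sends negative reals to 0; as the left side is
      positive, the inequality holds between the reals themselves.\<close>
    using d_pos by (subst (asm) ennreal_le_iff2) auto
  ultimately have "1 / (2 * d) \<le> \<psi> T" by simp
  then have "1 / (2 * d) / (6 / d) \<le> \<psi> T / (6 / d)"
    using d_pos by (intro divide_right_mono) auto
  moreover have "T powr (1 / (p - 1)) = 6 / d"
    using T_pos by (simp add: d_def)
  ultimately show False
    using N[OF T(1)] d_pos by (simp add: mult_ac)
qed

section \<open>Reflection and the operator M^-\<close>

definition reflect :: "(real \<Rightarrow> 'a) \<Rightarrow> real \<Rightarrow> 'a" where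
  "reflect f x = f (- x)"

lemma reflect_reflect [simp]: "reflect (reflect f) = f"
  by (simp add: reflect_def fun_eq_iff)

lemma nn_integral_lebesgue_reflect:
  "(\<integral>\<^sup>+x. g (- x) \<partial>lebesgue) = (\<integral>\<^sup>+x. g x \<partial>lebesgue)" for g :: "real \<Rightarrow> ennreal"
  unfolding nn_integral_completion by (rule nn_integral_lborel_reflect)

lemma set_nn_integral_lebesgue_reflect:
  fixes f :: "real \<Rightarrow> ennreal"
  shows "(\<integral>\<^sup>+t\<in>{x..y}. f (- t) \<partial>lebesgue) = (\<integral>\<^sup>+t\<in>{- y..- x}. f t \<partial>lebesgue)"
proof -
  have "(\<integral>\<^sup>+t\<in>{x..y}. f (- t) \<partial>lebesgue) = (\<integral>\<^sup>+t. f (- t) * indicator {- y..- x} (- t) \<partial>lebesgue)"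
    by (intro nn_integral_cong) (auto split: split_indicator)
  also have "\<dots> = (\<integral>\<^sup>+t\<in>{- y..- x}. f t \<partial>lebesgue)"
    by (rule nn_integral_lebesgue_reflect)
  finally show ?thesis .
qed

lemma measurable_reflect:
  "f \<in> borel_measurable lebesgue \<Longrightarrow> reflect f \<in> borel_measurable lebesgue" for f :: "real \<Rightarrow> real"
  using measurable_compose[OF lebesgue_measurable_scaling[of "-1"], of f borel]
  by (simp add: reflect_def[abs_def])

text \<open>The exceptional set lies in a Borel null set, whose reflection is again null by
  \<open>nn_integral_lborel_reflect\<close>.\<close>

lemma AE_lebesgue_reflect:
  fixes P :: "real \<Rightarrow> bool"
  assumes "AE x in lebesgue. P x"
  shows "AE x in lebesgue. P (- x)"
proof -
  obtain N where N: "{x. \<not> P x} \<subseteq> N" "N \<in> null_sets lborel"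
    using assms unfolding AE_completion_iff by (auto simp: eventually_ae_filter)
  have [measurable]: "N \<in> sets borel" using N(2) by auto
  have "(\<integral>\<^sup>+x. indicator N (- x) \<partial>lborel) = 0"
    using N(2) by (subst nn_integral_lborel_reflect) auto
  then have "AE x in lborel. - x \<notin> N"
    by (subst (asm) nn_integral_0_iff_AE) (auto simp: indicator_eq_0_iff)
  then have "AE x in lborel. P (- x)"
    by (rule AE_mp) (use N(1) in auto)
  then show ?thesis by (rule AE_completion)
qed

lemma weight_reflect:
  assumes "weight w"
  shows "weight (reflect w)"
  unfolding weight_def
proof (intro conjI allI impI)
  show "reflect w \<in> borel_measurable lebesgue"
    using assms by (intro measurable_reflect) (simp add: weight_def)
  show "AE x in lebesgue. 0 < reflect w x"
    using assms AE_lebesgue_reflect[of "\<lambda>x. 0 < w x"] by (simp add: weight_def reflect_def)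
  fix K :: "real set" assume "compact K"
  then have "compact (uminus ` K)"
    by (intro compact_continuous_image continuous_intros)
  then have "set_integrable lebesgue (uminus ` K) w"
    using assms by (simp add: weight_def)
  \<comment> \<open>\<open>0 + - 1 * x\<close> is -x in the shape of the affine substitution
    rule.\<close>
  then have "integrable lebesgue (\<lambda>x. indicator (uminus ` K) (0 + - 1 * x) *\<^sub>R w (0 + - 1 * x))"
    unfolding set_integrable_def by (subst lebesgue_integrable_real_affine_iff) auto
  moreover have "indicator (uminus ` K) (- x) = (indicator K x :: real)" for x
    by (auto simp: indicator_def)
  ultimately show "set_integrable lebesgue K (reflect w)"
    by (simp add: set_integrable_def reflect_def)
qed

lemma maximal_minus_eq: "maximal_minus f x = maximal_plus (reflect f) (- x)"
proof -
  have "(\<integral>\<^sup>+t\<in>{- x..- x + h}. ennreal \<bar>reflect f t\<bar> \<partial>lebesgue) = (\<integral>\<^sup>+t\<in>{x - h..x}. ennreal \<bar>f t\<bar> \<partial>lebesgue)" for h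
    using set_nn_integral_lebesgue_reflect[of "\<lambda>t. ennreal \<bar>f t\<bar>" "- x" "- x + h"]
    by (simp add: reflect_def)
  then show ?thesis
    by (simp add: maximal_minus_def maximal_plus_def)
qed

lemma Lp_norm_reflect: "Lp_norm p (reflect w) (\<lambda>x. g (- x)) = Lp_norm p w g"
  using nn_integral_lebesgue_reflect[of "\<lambda>x. ennreal_powr (g x) p * ennreal (w x)"]
  by (simp add: Lp_norm_def reflect_def)

text \<open>Reflection is an involution that carries the unit ball for \<open>w\<close>
  isometrically onto the one for \<open>reflect w\<close> and intertwines the two operators.\<close>

lemma op_norm_maximal_minus_eq: "op_norm p w maximal_minus = op_norm p (reflect w) maximal_plus"
proof -
  have norm: "Lp_norm p (reflect w) (\<lambda>x. ennreal \<bar>reflect f x\<bar>) = Lp_norm p w (\<lambda>x. ennreal \<bar>f x\<bar>)" for w f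
    using Lp_norm_reflect[of p w "\<lambda>x. ennreal \<bar>f x\<bar>"] by (simp add: reflect_def)
  have maximal: "Lp_norm p w (maximal_minus f) = Lp_norm p (reflect w) (maximal_plus (reflect f))" for f
    using Lp_norm_reflect[of p w "maximal_minus f"] by (simp add: maximal_minus_eq)
  show ?thesis
  proof (rule antisym)
    show "op_norm p w maximal_minus \<le> op_norm p (reflect w) maximal_plus"
      unfolding op_norm_def
      by (rule SUP_mono, rule_tac x = "reflect f" for f in bexI) (auto simp: norm maximal measurable_reflect)
    show "op_norm p (reflect w) maximal_plus \<le> op_norm p w maximal_minus"
      unfolding op_norm_def
    proof (rule SUP_mono)
      fix f assume "f \<in> {f \<in> borel_measurable lebesgue. Lp_norm p (reflect w) (\<lambda>x. ennreal \<bar>f x\<bar>) \<le> 1}"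
      then have "reflect f \<in> {f \<in> borel_measurable lebesgue. Lp_norm p w (\<lambda>x. ennreal \<bar>f x\<bar>) \<le> 1}"
        using norm[of "reflect w" f] by (simp add: measurable_reflect)
      then show "\<exists>g\<in>{f \<in> borel_measurable lebesgue. Lp_norm p w (\<lambda>x. ennreal \<bar>f x\<bar>) \<le> 1}.
          Lp_norm p (reflect w) (maximal_plus f) \<le> Lp_norm p w (maximal_minus g)"
        by (rule bexI[rotated]) (simp add: maximal)
    qed
  qed
qed

lemma Ap_minus_char_eq: "Ap_minus_char p w = Ap_plus_char p (reflect w)"
proof -
  let ?F = "\<lambda>x. SUP h\<in>{0<..}. (ennreal (1 / h) * (\<integral>\<^sup>+t\<in>{x - h..x}. ennreal (reflect w t) \<partial>lebesgue)) *
     ennreal_powr (ennreal (1 / h) *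
       (\<integral>\<^sup>+t\<in>{x..x + h}. ennreal (reflect w t powr (1 - conj_exp p)) \<partial>lebesgue)) (p - 1)"
  have w: "(\<integral>\<^sup>+t\<in>{- x - h..- x}. ennreal (reflect w t) \<partial>lebesgue) = (\<integral>\<^sup>+t\<in>{x..x + h}. ennreal (w t) \<partial>lebesgue)" for x h
    using set_nn_integral_lebesgue_reflect[of "\<lambda>t. ennreal (w t)" "- x - h" "- x"]
    by (simp add: reflect_def add.commute)
  have s: "(\<integral>\<^sup>+t\<in>{- x..- x + h}. ennreal (reflect w t powr (1 - conj_exp p)) \<partial>lebesgue)
    = (\<integral>\<^sup>+t\<in>{x - h..x}. ennreal (w t powr (1 - conj_exp p)) \<partial>lebesgue)" for x h
    using set_nn_integral_lebesgue_reflect[of "\<lambda>t. ennreal (w t powr (1 - conj_exp p))" "- x" "- x + h"]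
    by (simp add: reflect_def)
  have "Ap_minus_char p w = (SUP x. ?F (- x))"
    unfolding Ap_minus_char_def w s ..
  \<comment> \<open>Negation permutes the points x, so the supremum is unchanged.\<close>
  also have "\<dots> = (SUP x\<in>range uminus. ?F x)"
    by (simp only: image_image)
  also have "\<dots> = Ap_plus_char p (reflect w)"
    by (simp add: Ap_plus_char_def)
  finally show ?thesis .
qed

lemma reflect_in_Ap_plus_iff: "reflect w \<in> Ap_plus p \<longleftrightarrow> w \<in> Ap_minus p"
  using weight_reflect[of w] weight_reflect[of "reflect w"]
  by (auto simp: Ap_plus_def Ap_minus_def Ap_minus_char_eq)

theorem theorem2p1:
  fixes p :: real
  assumes "1 < p"
  shows
    "((\<exists>c>0. \<forall>w\<in>Ap_plus p.
         op_norm p w maximal_plus \<le> ennreal c * ennreal_powr (Ap_plus_char p w) (1 / (p - 1)))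
      \<and> \<not> (\<exists>\<psi> :: real \<Rightarrow> real.
            (\<forall>t\<ge>1. 0 < \<psi> t) \<and> mono_on {1..} \<psi>
          \<and> ((\<lambda>t. \<psi> t / t powr (1 / (p - 1))) \<longlongrightarrow> 0) at_top
          \<and> (\<forall>w\<in>Ap_plus p.
               op_norm p w maximal_plus \<le> ennreal (\<psi> (enn2real (Ap_plus_char p w))))))
     \<and>
     ((\<exists>c>0. \<forall>w\<in>Ap_minus p.
         op_norm p w maximal_minus \<le> ennreal c * ennreal_powr (Ap_minus_char p w) (1 / (p - 1)))
      \<and> \<not> (\<exists>\<psi> :: real \<Rightarrow> real.
            (\<forall>t\<ge>1. 0 < \<psi> t) \<and> mono_on {1..} \<psi>
          \<and> ((\<lambda>t. \<psi> t / t powr (1 / (p - 1))) \<longlongrightarrow> 0) at_top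
          \<and> (\<forall>w\<in>Ap_minus p.
               op_norm p w maximal_minus \<le> ennreal (\<psi> (enn2real (Ap_minus_char p w))))))"
proof -
  let ?c = "(2 * p) powr (1 / (p - 1)) * conj_exp p"
  have c: "0 < ?c" using assms by (simp add: conj_exp_def)
  have minus: "op_norm p w maximal_minus \<le> ennreal ?c * ennreal_powr (Ap_minus_char p w) (1 / (p - 1))"
    if "w \<in> Ap_minus p" for w
    using op_norm_maximal_plus_le[OF assms, of "reflect w"] that
    by (simp add: reflect_in_Ap_plus_iff op_norm_maximal_minus_eq Ap_minus_char_eq)
  \<comment> \<open>Every weight in A_p^+ is the reflection of one in A_p^-, so a function \<psi>
    admissible for M^- would be admissible for M^+ as well.\<close>
  have sharp_minus: False
    if "mono_on {1..} \<psi>" "((\<lambda>t. \<psi> t / t powr (1 / (p - 1))) \<longlongrightarrow> 0) at_top"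
      "\<forall>w\<in>Ap_minus p. op_norm p w maximal_minus \<le> ennreal (\<psi> (enn2real (Ap_minus_char p w)))" for \<psi>
  proof (rule exponent_sharp_plus[OF assms that(1,2)])
    fix w assume "w \<in> Ap_plus p"
    then have "reflect w \<in> Ap_minus p"
      using reflect_in_Ap_plus_iff[of "reflect w" p] by simp
    with that(3) show "op_norm p w maximal_plus \<le> ennreal (\<psi> (enn2real (Ap_plus_char p w)))"
      by (metis op_norm_maximal_minus_eq Ap_minus_char_eq reflect_reflect)
  qed
  show ?thesis
  proof (intro conjI)
    show "\<exists>c>0. \<forall>w\<in>Ap_plus p.
        op_norm p w maximal_plus \<le> ennreal c * ennreal_powr (Ap_plus_char p w) (1 / (p - 1))"
      using c op_norm_maximal_plus_le[OF assms] by blast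
    show "\<exists>c>0. \<forall>w\<in>Ap_minus p.
        op_norm p w maximal_minus \<le> ennreal c * ennreal_powr (Ap_minus_char p w) (1 / (p - 1))"
      using c minus by blast
  qed (use exponent_sharp_plus[OF assms] sharp_minus in blast)+
qed

end
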